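(* Assume $\mu\le H^2$, $\lambda_\mu>0$, $0<\mu<\left(\frac{N-2}{2}\right)^2$ and $p\ge\frac{N+1}{N-1}$. Then there exists a measure $\tau\in\mathfrak M^+(\Omega\setminus\Sigma;\phi_\mu)$ with $\|\tau\|_{\mathfrak M(\Omega\setminus\Sigma;\phi_\mu)}=1$ such that the equation $$u=\mathbb G_\mu[u^p]+\rho\,\mathbb G_\mu[\tau]$$ does not admit a positive solution for any $\rho>0$.
   Context: Setting. $N\ge 3$; $\Omega\subset\mathbb R^N$ is a bounded $C^2$ domain; $\Sigma\subset\Omega$ is a compact $C^2$ submanifold without boundary of dimension $k$, $0\le k<N-2$ (if $k=0$, $\Sigma=\{0\}$). $d(x)=\mathrm{dist}(x,\partial\Omega)$, $d_\Sigma(x)=\mathrm{dist}(x,\Sigma)$, $L_\mu=\Delta+\mu d_\Sigma^{-2}$ in $\Omega\setminus\Sigma$, $H=\frac{N-k-2}{2}$. For $\mu\le H^2$: $\alpha_\pm=H\pm\sqrt{H^2-\mu}$, and $\lambda_\mu=\inf\{\int_\Omega(|\nabla u|^2-\mu d_\Sigma^{-2}u^2)dx:\ u\in C_c^1(\Omega),\ \int_\Omega u^2dx=1\}$. $\phi_\mu$ denotes the positive eigenfunction, $-L_\mu\phi_\mu=\lambda_\mu\phi_\mu$ in $\Omega\setminus\Sigma$, normalized by $\|\phi_\mu\|_{L^2(\Omega)}=1$; it satisfies $\phi_\mu\approx d\,d_\Sigma^{-\alpha_-}$ (two-sided bound up to positive constants) in $\Omega\setminus\Sigma$. When $\lambda_\mu>0$,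 $G_\mu$ is the Green kernel of $-L_\mu$ in $\Omega\setminus\Sigma$ (the increasing limit of the Dirichlet Green kernels of $-L_\mu$ on a smooth exhaustion of $\Omega\setminus\Sigma$). $\mathbb G_\mu[\tau](x)=\int_{\Omega\setminus\Sigma}G_\mu(x,y)\,d\tau(y)$, and $\mathbb G_\mu[f]=\mathbb G_\mu[f\,dx]$ for nonnegative functions $f$. Solutions of the integral equation are functions $u$ with $u^p\in L^1(\Omega;\phi_\mu)$ satisfying it a.e. in $\Omega\setminus\Sigma$. $\mathfrak M^+(\Omega\setminus\Sigma;\phi_\mu)$ is the set of nonnegative Radon measures $\tau$ on $\Omega\setminus\Sigma$ with $\|\tau\|_{\mathfrak M(\Omega\setminus\Sigma;\phi_\mu)}=\int\phi_\mu\,d\tau<\infty$. *)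

theory Defs
  imports "HOL-Analysis.Analysis"
begin

section \<open>Regularity of functions, domains and submanifolds\<close>

text \<open>The first argument is the order of differentiability. The definition is meant for open sets.\<close>

fun Ck_on :: "nat \<Rightarrow> 'a::euclidean_space set \<Rightarrow> ('a \<Rightarrow> 'b::real_normed_vector) \<Rightarrow> bool" where
  "Ck_on 0 U f \<longleftrightarrow> continuous_on U f"
| "Ck_on (Suc r) U f \<longleftrightarrow>
     (\<forall>x\<in>U. f differentiable (at x)) \<and>
     (\<forall>v. Ck_on r U (\<lambda>x. frechet_derivative f (at x) v))"

definition grad :: "('a::euclidean_space \<Rightarrow> real) \<Rightarrow> 'a \<Rightarrow> 'a" where
  "grad f x = (\<Sum>b\<in>Basis. frechet_derivative f (at x) b *\<^sub>R b)"

definition laplacian :: "('a::euclidean_space \<Rightarrow> real) \<Rightarrow> 'a \<Rightarrow> real" where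
  "laplacian f x = (\<Sum>b\<in>Basis. frechet_derivative (\<lambda>z. frechet_derivative f (at z) b) (at x) b)"

text \<open>Functions of class \<open>C\<close>\<open>r\<close> with compact support in the open set \<open>D\<close>,
  extended by zero to the whole space.\<close>

definition Ck_compact_support :: "nat \<Rightarrow> 'a::euclidean_space set \<Rightarrow> ('a \<Rightarrow> real) \<Rightarrow> bool" where
  "Ck_compact_support r D \<zeta> \<longleftrightarrow>
     Ck_on r UNIV \<zeta> \<and> compact (closure {x. \<zeta> x \<noteq> 0}) \<and> closure {x. \<zeta> x \<noteq> 0} \<subseteq> D"

text \<open>The set lies locally on one side of its boundary, which is the zero set of a
  defining function with nonvanishing gradient.\<close>

definition Ck_boundary :: "nat \<Rightarrow> 'a::euclidean_space set \<Rightarrow> bool" where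
  "Ck_boundary r D \<longleftrightarrow>
     (\<forall>q\<in>frontier D. \<exists>U (\<psi> :: 'a \<Rightarrow> real).
        open U \<and> q \<in> U \<and> Ck_on r U \<psi> \<and> (\<forall>x\<in>U. grad \<psi> x \<noteq> 0) \<and>
        D \<inter> U = {x \<in> U. \<psi> x < 0})"

definition bounded_Ck_domain :: "nat \<Rightarrow> 'a::euclidean_space set \<Rightarrow> bool" where
  "bounded_Ck_domain r D \<longleftrightarrow>
     open D \<and> connected D \<and> D \<noteq> {} \<and> bounded D \<and> Ck_boundary r D"

text \<open>Embedded submanifolds without boundary of dimension \<open>k\<close>: locally, a diffeomorphism of
  class \<open>C\<close>\<open>r\<close> of the ambient space flattens the set to a \<open>k\<close>-dimensional linear subspace.\<close>

definition Ck_submanifold :: "nat \<Rightarrow> nat \<Rightarrow> 'a::euclidean_space set \<Rightarrow> bool" where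
  "Ck_submanifold r k S \<longleftrightarrow>
     S \<noteq> {} \<and>
     (\<forall>q\<in>S. \<exists>U V (\<Psi> :: 'a \<Rightarrow> 'a) \<Psi>' L.
        open U \<and> q \<in> U \<and> open V \<and> homeomorphism U V \<Psi> \<Psi>' \<and>
        Ck_on r U \<Psi> \<and> Ck_on r V \<Psi>' \<and>
        subspace L \<and> dim L = k \<and> \<Psi> ` (S \<inter> U) = V \<inter> L)"

section \<open>The Hardy operator and its ground state\<close>

definition hardy_H :: "nat \<Rightarrow> nat \<Rightarrow> real" where
  "hardy_H N k = (real N - real k - 2) / 2"

definition alpha_minus :: "nat \<Rightarrow> nat \<Rightarrow> real \<Rightarrow> real" where
  "alpha_minus N k \<mu> = hardy_H N k - sqrt ((hardy_H N k)\<^sup>2 - \<mu>)"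

definition hardy_L :: "'a::euclidean_space set \<Rightarrow> real \<Rightarrow> ('a \<Rightarrow> real) \<Rightarrow> 'a \<Rightarrow> real" where
  "hardy_L \<Sigma> \<mu> f x = laplacian f x + \<mu> / (infdist x \<Sigma>)\<^sup>2 * f x"

text \<open>The infimum is taken in the extended reals, so that no convention about
  sets of reals that are unbounded below enters.\<close>

definition first_eigenvalue :: "'a::euclidean_space set \<Rightarrow> 'a set \<Rightarrow> real \<Rightarrow> ereal" where
  "first_eigenvalue \<Omega> \<Sigma> \<mu> =
     Inf {ereal (LINT x:\<Omega>|lebesgue. (norm (grad u x))\<^sup>2 - \<mu> / (infdist x \<Sigma>)\<^sup>2 * (u x)\<^sup>2) | u.
            Ck_compact_support 1 \<Omega> u \<and> (LINT x:\<Omega>|lebesgue. (u x)\<^sup>2) = 1}"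

text \<open>The positive normalized eigenfunction. The two-sided bound carries the boundary behaviour
  at \<open>\<partial>\<Omega>\<close> and at \<open>\<Sigma>\<close>, which the equation in \<open>\<Omega> - \<Sigma>\<close> alone does not prescribe.\<close>

definition ground_state ::
  "'a::euclidean_space set \<Rightarrow> 'a set \<Rightarrow> nat \<Rightarrow> real \<Rightarrow> ('a \<Rightarrow> real) \<Rightarrow> bool" where
  "ground_state \<Omega> \<Sigma> k \<mu> \<phi> \<longleftrightarrow>
     Ck_on 2 (\<Omega> - \<Sigma>) \<phi> \<and>
     (\<forall>x\<in>\<Omega> - \<Sigma>. \<phi> x > 0) \<and>
     (\<forall>x\<in>\<Omega> - \<Sigma>. - hardy_L \<Sigma> \<mu> \<phi> x = real_of_ereal (first_eigenvalue \<Omega> \<Sigma> \<mu>) * \<phi> x) \<and>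
     (LINT x:\<Omega>|lebesgue. (\<phi> x)\<^sup>2) = 1 \<and>
     (\<exists>c>0. \<exists>C>0. \<forall>x\<in>\<Omega> - \<Sigma>.
        (let w = infdist x (frontier \<Omega>) * infdist x \<Sigma> powr (- alpha_minus DIM('a) k \<mu>)
         in c * w \<le> \<phi> x \<and> \<phi> x \<le> C * w))"

section \<open>Green kernels and potentials\<close>

text \<open>Dirichlet Green kernel of \<open>- L\<close>\<open>\<mu>\<close> in a domain \<open>D\<close> whose closure does not meet \<open>\<Sigma>\<close>:
  for each pole \<open>y \<in> D\<close>, the function \<open>g(\<sqdot>, y)\<close> is nonnegative, continuous up to the boundary
  away from the pole, vanishes on the boundary, and satisfies \<open>- L\<close>\<open>\<mu>\<close> \<open>g(\<sqdot>, y) = \<delta>\<close>\<open>y\<close>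
  in the sense of distributions. Values for \<open>x = y\<close> are left open.\<close>

definition dirichlet_green_kernel ::
  "'a::euclidean_space set \<Rightarrow> real \<Rightarrow> 'a set \<Rightarrow> ('a \<Rightarrow> 'a \<Rightarrow> real) \<Rightarrow> bool" where
  "dirichlet_green_kernel \<Sigma> \<mu> D g \<longleftrightarrow>
     (\<forall>y\<in>D.
        (\<forall>x\<in>D - {y}. 0 \<le> g x y) \<and>
        continuous_on (closure D - {y}) (\<lambda>x. g x y) \<and>
        (\<forall>x\<in>frontier D. g x y = 0) \<and>
        set_integrable lebesgue D (\<lambda>x. g x y) \<and>
        (\<forall>\<zeta>. Ck_compact_support 2 D \<zeta> \<longrightarrow>
           (LINT x:D|lebesgue. g x y * (- hardy_L \<Sigma> \<mu> \<zeta> x)) = \<zeta> y))"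

definition smooth_exhaustion :: "'a::euclidean_space set \<Rightarrow> (nat \<Rightarrow> 'a set) \<Rightarrow> bool" where
  "smooth_exhaustion W D \<longleftrightarrow>
     (\<forall>n. (\<forall>r. bounded_Ck_domain r (D n)) \<and> closure (D n) \<subseteq> D (Suc n)) \<and> (\<Union>n. D n) = W"

text \<open>Green kernel of \<open>- L\<close>\<open>\<mu>\<close> in \<open>\<Omega> - \<Sigma>\<close>. For \<open>x, y \<in> \<Omega> - \<Sigma>\<close> both points belong to \<open>D n\<close>
  for all large \<open>n\<close>. Values on the diagonal, where the kernel has its pole, and values outside
  \<open>\<Omega> - \<Sigma>\<close> are not prescribed.\<close>

definition green_kernel ::
  "'a::euclidean_space set \<Rightarrow> 'a set \<Rightarrow> real \<Rightarrow> ('a \<Rightarrow> 'a \<Rightarrow> ennreal) \<Rightarrow> bool" where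
  "green_kernel \<Omega> \<Sigma> \<mu> G \<longleftrightarrow>
     (\<exists>D g. smooth_exhaustion (\<Omega> - \<Sigma>) D \<and>
        (\<forall>n. dirichlet_green_kernel \<Sigma> \<mu> (D n) (g n)) \<and>
        (\<forall>x\<in>\<Omega> - \<Sigma>. \<forall>y\<in>\<Omega> - \<Sigma>. x \<noteq> y \<longrightarrow> (\<lambda>n. ennreal (g n x y)) \<longlonglongrightarrow> G x y))"

definition green_measure :: "('a \<Rightarrow> 'a \<Rightarrow> ennreal) \<Rightarrow> 'a measure \<Rightarrow> 'a \<Rightarrow> ennreal" where
  "green_measure G \<tau> x = (\<integral>\<^sup>+ y. G x y \<partial>\<tau>)"

definition green_function ::
  "'a::euclidean_space set \<Rightarrow> ('a \<Rightarrow> 'a \<Rightarrow> ennreal) \<Rightarrow> ('a \<Rightarrow> real) \<Rightarrow> 'a \<Rightarrow> ennreal" where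
  "green_function W G f x = (\<integral>\<^sup>+ y \<in> W. (G x y * ennreal (f y)) \<partial>lebesgue)"

definition radon_measure_on :: "'a::euclidean_space set \<Rightarrow> 'a measure \<Rightarrow> bool" where
  "radon_measure_on W \<tau> \<longleftrightarrow>
     space \<tau> = W \<and> sets \<tau> = sets (restrict_space borel W) \<and>
     (\<forall>K. compact K \<and> K \<subseteq> W \<longrightarrow> emeasure \<tau> K < \<infinity>)"

definition weighted_mass :: "('a \<Rightarrow> real) \<Rightarrow> 'a measure \<Rightarrow> ennreal" where
  "weighted_mass \<phi> \<tau> = (\<integral>\<^sup>+ x. ennreal (\<phi> x) \<partial>\<tau>)"

text \<open>Positive solutions of \<open>u = \<G>[u\<^sup>p] + \<rho> \<G>[\<tau>]\<close> in \<open>W = \<Omega> - \<Sigma>\<close>; the weighted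
  integrability over \<open>\<Omega>\<close> is the one over \<open>W\<close>, since \<open>\<Sigma>\<close> is a null set.\<close>

definition positive_solution ::
  "'a::euclidean_space set \<Rightarrow> ('a \<Rightarrow> 'a \<Rightarrow> ennreal) \<Rightarrow> ('a \<Rightarrow> real) \<Rightarrow> real \<Rightarrow> real \<Rightarrow>
     'a measure \<Rightarrow> ('a \<Rightarrow> real) \<Rightarrow> bool" where
  "positive_solution W G \<phi> p \<rho> \<tau> u \<longleftrightarrow>
     set_borel_measurable lebesgue W u \<and>
     (AE x in lebesgue. x \<in> W \<longrightarrow> u x > 0) \<and>
     set_integrable lebesgue W (\<lambda>x. u x powr p * \<phi> x) \<and>
     (AE x in lebesgue. x \<in> W \<longrightarrow>
        ennreal (u x) = green_function W G (\<lambda>y. u y powr p) x + ennreal \<rho> * green_measure G \<tau> x)"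

end

theory Submission
  imports Defs
begin

text \<open>Since \<open>\<mu> > 0\<close>, the Green kernel is superharmonic for the Laplacian as well, and near a point
  \<open>z \<in> \<partial>\<Omega>\<close> touched by an interior ball with inner normal \<open>e\<close> it is bounded below as the kernel of
  the Laplacian in a ball: \<open>G(x, z + 2\<epsilon>e) \<ge> \<kappa> \<epsilon> r\<^sup>1\<^sup>-\<^sup>N\<close> for \<open>x\<close> in the ball \<open>B(z + re, r/8)\<close>, \<open>\<epsilon> \<le> r/8\<close>.
  As \<open>\<phi>\<close> is comparable to the distance to \<open>\<partial>\<Omega>\<close>, every such ball contributes at least a multiple of
  \<open>r\<close> to the power \<open>N + 1 - (N - 1) p \<le> 0\<close> to the integral of \<open>(G(x, y) / \<phi> y)\<^sup>p \<phi>(x)\<close>, \<open>y = z + 2\<epsilon>e\<close>,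
  so that this integral tends to infinity as \<open>\<epsilon> \<rightarrow> 0\<close>. A suitable sum of Dirac masses
  at such points, normalized by \<open>\<phi>\<close>, is the measure \<open>\<tau>\<close>, since a solution \<open>u\<close> dominates \<open>\<rho> \<G>[\<tau>]\<close>.\<close>

section \<open>Radial test functions\<close>

text \<open>Values and slopes of the two pieces agree at \<open>a\<close>, so the one-sided
  derivatives there coincide. All piecewise profiles below are differentiated by means of this
  lemma.\<close>

lemma has_real_derivative_glue:
  fixes f g f' g' :: "real \<Rightarrow> real"
  assumes f: "\<And>t. t \<le> a \<Longrightarrow> (f has_real_derivative f' t) (at t)"
    and g: "\<And>t. t \<ge> a \<Longrightarrow> (g has_real_derivative g' t) (at t)"
    and eq: "f a = g a" "f' a = g' a"
  shows "((\<lambda>t. if t \<le> a then f t else g t) has_real_derivative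
           (if t \<le> a then f' t else g' t)) (at t)"
proof -
  have "((\<lambda>t. if t \<in> {..a} then f t else g t) has_vector_derivative
           (if t \<in> {..a} then f' t else g' t)) (at t within ({..a} \<union> {a<..}))"
    by (rule has_vector_derivative_If_within_closures)
      (use f g eq in \<open>auto simp: has_real_derivative_iff_has_vector_derivative[symmetric]
         intro: has_field_derivative_at_within\<close>)
  moreover have "{..a} \<union> {a<..} = UNIV" by auto
  ultimately show ?thesis
    by (simp add: has_real_derivative_iff_has_vector_derivative)
qed

text \<open>The exponent is at least 2, since the slope of the power has to vanish at 0 for it to
  join the zero function.\<close>

lemma has_real_derivative_max_power:
  "((\<lambda>t::real. max 0 t ^ Suc (Suc n)) has_real_derivative
     real (Suc (Suc n)) * max 0 t ^ Suc n) (at t)"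
proof -
  have "((\<lambda>t::real. if t \<le> 0 then 0 else t ^ Suc (Suc n)) has_real_derivative
          (if t \<le> 0 then 0 else real (Suc (Suc n)) * t ^ Suc n)) (at t)"
    by (rule has_real_derivative_glue) (use DERIV_pow[of "Suc (Suc n)"] in \<open>simp_all\<close>)
  moreover have "(\<lambda>t::real. if t \<le> 0 then 0 else t ^ Suc (Suc n)) = (\<lambda>t. max 0 t ^ Suc (Suc n))"
    by (auto simp: fun_eq_iff max_def)
  moreover have "(if t \<le> 0 then 0 else real (Suc (Suc n)) * t ^ Suc n) = real (Suc (Suc n)) * max 0 t ^ Suc n"
    by (auto simp: max_def)
  ultimately show ?thesis by simp
qed

text \<open>The profile takes the squared distance, a polynomial in \<open>x\<close>, so smoothness
  at the centre \<open>a\<close> is automatic. In the sum over the basis the squared coordinates of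
  \<open>x - a\<close> add up to the squared distance, and \<open>DIM('a)\<close> equal terms give
  the second summand.\<close>

lemma radial_test_function:
  fixes a :: "'a::euclidean_space" and \<psi> \<psi>1 \<psi>2 :: "real \<Rightarrow> real"
  assumes 1: "\<And>s. (\<psi> has_real_derivative \<psi>1 s) (at s)"
    and 2: "\<And>s. (\<psi>1 has_real_derivative \<psi>2 s) (at s)"
    and 3: "continuous_on UNIV \<psi>2"
    and supp: "\<And>s. s \<ge> \<rho>\<^sup>2 \<Longrightarrow> \<psi> s = 0" and "\<rho> \<ge> 0" and sub: "cball a \<rho> \<subseteq> D"
  defines "\<zeta> \<equiv> (\<lambda>x. \<psi> ((dist a x)\<^sup>2))"
  shows "Ck_compact_support 2 D \<zeta>"
    and "laplacian \<zeta> x = 4 * (dist a x)\<^sup>2 * \<psi>2 ((dist a x)\<^sup>2) + 2 * real DIM('a) * \<psi>1 ((dist a x)\<^sup>2)"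
proof -
  have sq: "(dist a x)\<^sup>2 = (x - a) \<bullet> (x - a)" for x
    by (subst dist_commute) (simp add: dist_norm power2_norm_eq_inner)
  have q: "((\<lambda>x. (x - a) \<bullet> (x - a)) has_derivative (\<lambda>h. 2 * ((x - a) \<bullet> h))) (at x)" for x
    by (auto intro!: derivative_eq_intros simp: inner_commute)
  have D1: "(\<zeta> has_derivative (\<lambda>h. \<psi>1 ((x - a) \<bullet> (x - a)) * (2 * ((x - a) \<bullet> h)))) (at x)" for x
    unfolding \<zeta>_def sq using has_derivative_compose[OF q 1[unfolded has_field_derivative_def]]
    by (simp add: mult_ac)
  have F1: "frechet_derivative \<zeta> (at x) v = \<psi>1 ((x - a) \<bullet> (x - a)) * (2 * ((x - a) \<bullet> v))" for x v
    by (rule fun_cong[OF frechet_derivative_at[OF D1], symmetric])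
  have D1': "((\<lambda>x. \<psi>1 ((x - a) \<bullet> (x - a))) has_derivative (\<lambda>h. \<psi>2 ((x - a) \<bullet> (x - a)) * (2 * ((x - a) \<bullet> h)))) (at x)" for x
    using has_derivative_compose[OF q 2[unfolded has_field_derivative_def]]
    by (simp add: mult_ac)
  have D2: "((\<lambda>x. frechet_derivative \<zeta> (at x) v) has_derivative
      (\<lambda>w. \<psi>2 ((x - a) \<bullet> (x - a)) * (2 * ((x - a) \<bullet> w)) * (2 * ((x - a) \<bullet> v)) +
           \<psi>1 ((x - a) \<bullet> (x - a)) * (2 * (w \<bullet> v)))) (at x)" for x v
    unfolding F1 by (rule derivative_eq_intros D1' refl)+ (auto simp: algebra_simps)
  have F2: "frechet_derivative (\<lambda>x. frechet_derivative \<zeta> (at x) v) (at x) w =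
      \<psi>2 ((x - a) \<bullet> (x - a)) * (2 * ((x - a) \<bullet> w)) * (2 * ((x - a) \<bullet> v)) +
           \<psi>1 ((x - a) \<bullet> (x - a)) * (2 * (w \<bullet> v))" for x v w
    by (rule fun_cong[OF frechet_derivative_at[OF D2], symmetric])
  have c1: "continuous_on UNIV \<psi>1"
    using 2 by (meson DERIV_continuous_on has_field_derivative_at_within)
  have "continuous_on UNIV (\<lambda>x. frechet_derivative (\<lambda>x. frechet_derivative \<zeta> (at x) v) (at x) w)" for v w
    unfolding F2
    by (intro continuous_intros continuous_on_compose2[OF 3] continuous_on_compose2[OF c1]) auto
  then have "Ck_on 2 UNIV \<zeta>"
    unfolding numeral_2_eq_2 Ck_on.simps using differentiableI[OF D1] differentiableI[OF D2] by blast
  moreover have "{x. \<zeta> x \<noteq> 0} \<subseteq> cball a \<rho>"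
    using supp \<open>\<rho> \<ge> 0\<close> unfolding \<zeta>_def
    by (auto simp: not_le) (meson less_le_not_le linorder_linear power_mono)
  then have "closure {x. \<zeta> x \<noteq> 0} \<subseteq> cball a \<rho>"
    by (simp add: closure_minimal)
  ultimately show "Ck_compact_support 2 D \<zeta>"
    unfolding Ck_compact_support_def using sub
    by (metis (no_types, lifting) bounded_cball bounded_subset closed_closure compact_eq_bounded_closed order_trans)
  have "laplacian \<zeta> x = (\<Sum>b\<in>Basis. 4 * \<psi>2 ((x - a) \<bullet> (x - a)) * (((x - a) \<bullet> b) * ((x - a) \<bullet> b)) + 2 * \<psi>1 ((x - a) \<bullet> (x - a)))"
    unfolding laplacian_def F2 by (intro sum.cong) (auto simp: inner_Basis algebra_simps)
  also have "\<dots> = 4 * \<psi>2 ((x - a) \<bullet> (x - a)) * ((x - a) \<bullet> (x - a)) + 2 * real DIM('a) * \<psi>1 ((x - a) \<bullet> (x - a))"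
    by (simp add: sum.distrib sum_distrib_left[symmetric] euclidean_inner[of "x - a" "x - a", symmetric])
  finally show "laplacian \<zeta> x = 4 * (dist a x)\<^sup>2 * \<psi>2 ((dist a x)\<^sup>2) + 2 * real DIM('a) * \<psi>1 ((dist a x)\<^sup>2)"
    unfolding sq by (simp add: mult_ac)
qed

text \<open>Testing the equation of the kernel with the radial function \<zeta> expresses
  \<open>\<zeta> y\<close> as the integral of \<open>g\<close> against minus the Hardy operator of
  \<zeta>. Since \<mu>, \<zeta> and \<open>g\<close> are nonnegative, the potential term only lowers
  this integral, so any bounded \<open>h\<close> above minus the Laplacian gives an upper bound. The
  kernel estimates below thus deal with the Laplacian alone.\<close>

lemma green_kernel_radial_test:
  fixes a :: "'a::euclidean_space" and \<psi> \<psi>1 \<psi>2 :: "real \<Rightarrow> real"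
  assumes g: "dirichlet_green_kernel \<Sigma> \<mu> D g" "y \<in> D"
    and D: "open D" "closed \<Sigma>" "\<Sigma> \<noteq> {}" "D \<inter> \<Sigma> = {}" "\<mu> \<ge> 0"
    and 1: "\<And>s. (\<psi> has_real_derivative \<psi>1 s) (at s)"
    and 2: "\<And>s. (\<psi>1 has_real_derivative \<psi>2 s) (at s)"
    and 3: "continuous_on UNIV \<psi>2"
    and supp: "\<And>s. s \<ge> \<rho>\<^sup>2 \<Longrightarrow> \<psi> s = 0" "\<And>s. s \<ge> \<rho>\<^sup>2 \<Longrightarrow> \<psi>1 s = 0" "\<And>s. s \<ge> \<rho>\<^sup>2 \<Longrightarrow> \<psi>2 s = 0"
    and \<rho>: "\<rho> \<ge> 0" "cball a \<rho> \<subseteq> D"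
    and nonneg: "\<And>s. 0 \<le> s \<Longrightarrow> 0 \<le> \<psi> s"
    and h: "h \<in> borel_measurable borel" "\<And>x. \<bar>h x\<bar> \<le> B"
    and le: "\<And>x. - (4 * (dist a x)\<^sup>2 * \<psi>2 ((dist a x)\<^sup>2) + 2 * real DIM('a) * \<psi>1 ((dist a x)\<^sup>2)) \<le> h x"
  shows "\<psi> ((dist a y)\<^sup>2) \<le> (LINT x:D|lebesgue. g x y * h x)"
proof -
  define \<zeta> where "\<zeta> = (\<lambda>x. \<psi> ((dist a x)\<^sup>2))"
  define l where "l = (\<lambda>x. 4 * (dist a x)\<^sup>2 * \<psi>2 ((dist a x)\<^sup>2) + 2 * real DIM('a) * \<psi>1 ((dist a x)\<^sup>2))"
  define q where "q = (\<lambda>x. - (l x + \<mu> / (infdist x \<Sigma>)\<^sup>2 * \<zeta> x))"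
  have zeta: "Ck_compact_support 2 D \<zeta>" and lap: "laplacian \<zeta> x = l x" for x
    unfolding \<zeta>_def l_def using radial_test_function[OF 1 2 3 supp(1) \<rho>] by auto
  have q: "- hardy_L \<Sigma> \<mu> \<zeta> x = q x" for x
    unfolding hardy_L_def lap q_def ..
  have c0: "continuous_on UNIV \<psi>" "continuous_on UNIV \<psi>1"
    using 1 2 by (meson DERIV_continuous_on has_field_derivative_at_within)+
  have cl: "continuous_on UNIV l" "continuous_on UNIV \<zeta>"
    unfolding l_def \<zeta>_def
    by (intro continuous_intros continuous_on_compose2[OF 3] continuous_on_compose2[OF c0(1)]
        continuous_on_compose2[OF c0(2)]; simp)+
  have pos: "0 < infdist x \<Sigma>" if "x \<in> D" for x
    using D that by (metis IntI empty_iff in_closed_iff_infdist_zero infdist_nonneg less_eq_real_def)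
  \<comment> \<open>The aim is that \<open>q\<close> is bounded, so that its product with
    \<open>g\<close> is integrable: on the compact ball, which misses \<Sigma>, the potential is
    continuous, and outside it the profile and both derivatives vanish.\<close>
  have "continuous_on (cball a \<rho>) q"
    unfolding q_def using pos \<rho>(2)
    by (intro continuous_intros continuous_on_subset[OF cl(1)] continuous_on_subset[OF cl(2)]) force+
  then have "bounded (q ` cball a \<rho>)"
    by (intro compact_imp_bounded compact_continuous_image) auto
  then obtain C where "\<forall>v\<in>q ` cball a \<rho>. norm v \<le> C"
    unfolding bounded_iff by blast
  then have C: "\<bar>q x\<bar> \<le> C" if "x \<in> cball a \<rho>" for x
    using that by simp
  have q0: "q x = 0" if "x \<notin> cball a \<rho>" for x
  proof -
    have "\<rho>\<^sup>2 \<le> (dist a x)\<^sup>2" using that \<rho>(1) by (intro power_mono) auto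
    then show ?thesis using supp by (simp add: q_def l_def \<zeta>_def)
  qed
  have qb: "\<bar>q x\<bar> \<le> \<bar>C\<bar>" for x
    using C[of x] q0[of x] by (cases "x \<in> cball a \<rho>") force+
  have [measurable]: "l \<in> borel_measurable borel" "\<zeta> \<in> borel_measurable borel"
    using cl by (auto intro: borel_measurable_continuous_onI)
  have [measurable]: "(\<lambda>x. infdist x \<Sigma>) \<in> borel_measurable borel"
    by (intro borel_measurable_continuous_onI continuous_intros)
  have qm: "q \<in> borel_measurable borel"
    unfolding q_def by measurable
  have gi: "integrable lebesgue (\<lambda>x. indicator D x * g x y)"
    using g by (simp add: dirichlet_green_kernel_def set_integrable_def)
  have int: "integrable lebesgue (\<lambda>x. indicator D x * (g x y * f x))"
    if "f \<in> borel_measurable borel" "\<And>x. \<bar>f x\<bar> \<le> K" for f :: "'a \<Rightarrow> real" and K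
  proof (rule Bochner_Integration.integrable_bound)
    show "integrable lebesgue (\<lambda>x. K * (indicator D x * g x y))"
      using gi by (rule integrable_mult_right)
    have "f \<in> borel_measurable lebesgue" using that(1) by (simp add: measurable_completion)
    then have "(\<lambda>x. (indicator D x * g x y) * f x) \<in> borel_measurable lebesgue"
      by (rule borel_measurable_times[OF borel_measurable_integrable[OF gi]])
    then show "(\<lambda>x. indicator D x * (g x y * f x)) \<in> borel_measurable lebesgue"
      by (simp add: mult_ac)
    have "0 \<le> K" using that(2)[of a] by linarith
    then show "AE x in lebesgue. norm (indicator D x * (g x y * f x)) \<le> norm (K * (indicator D x * g x y))"
      using that(2) by (auto simp: abs_mult indicator_def mult.commute[of K] intro!: mult_left_mono)
  qed
  have "\<psi> ((dist a y)\<^sup>2) = (LINT x:D|lebesgue. g x y * (- hardy_L \<Sigma> \<mu> \<zeta> x))"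
    using g zeta unfolding dirichlet_green_kernel_def \<zeta>_def by metis
  also have "\<dots> = (LINT x:D|lebesgue. g x y * q x)"
    by (simp add: q)
  also have "\<dots> \<le> (LINT x:D|lebesgue. g x y * h x)"
    unfolding set_lebesgue_integral_def real_scaleR_def
  proof (rule integral_mono_AE)
    \<comment> \<open>The sign of \<open>g\<close> is prescribed only off the pole \<open>y\<close>,
      a null set.\<close>
    show "AE x in lebesgue. indicator D x * (g x y * q x) \<le> indicator D x * (g x y * h x)"
      using AE_completion[OF AE_lborel_singleton[of y]]
    proof eventually_elim
      case (elim x)
      have "q x \<le> h x"
      proof -
        have "0 \<le> \<mu> / (infdist x \<Sigma>)\<^sup>2 * \<zeta> x"
          using nonneg D(5) by (simp add: \<zeta>_def)
        then show ?thesis using le[of x] by (simp add: q_def l_def)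
      qed
      moreover have "x \<in> D \<Longrightarrow> 0 \<le> g x y"
        using g elim unfolding dirichlet_green_kernel_def by blast
      ultimately show ?case by (auto simp: indicator_def mult_left_mono)
    qed
  qed (use int[OF qm qb] int[OF h] in auto)
  finally show ?thesis .
qed

section \<open>The super-mean-value inequality\<close>

text \<open>With \<open>\<beta> = (N - 2) / 2\<close> and \<open>s = |x|\<^sup>2\<close>, this is the fundamental solution of the Laplacian, replaced
  inside the ball \<open>s \<le> \<sigma>\<close> by its second Taylor polynomial in \<open>s\<close>; minus its Laplacian is a multiple
  of the positive part of \<open>\<sigma> - s\<close>.\<close>

definition trunc_pow :: "real \<Rightarrow> real \<Rightarrow> real \<Rightarrow> real" where
  "trunc_pow \<beta> \<sigma> s = (if s \<le> \<sigma>
     then \<sigma> powr - \<beta> - \<beta> * \<sigma> powr (- \<beta> - 1) * (s - \<sigma>)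
          + \<beta> * (\<beta> + 1) / 2 * \<sigma> powr (- \<beta> - 2) * (s - \<sigma>)\<^sup>2
     else s powr - \<beta>)"

definition trunc_pow_deriv :: "real \<Rightarrow> real \<Rightarrow> real \<Rightarrow> real" where
  "trunc_pow_deriv \<beta> \<sigma> s = (if s \<le> \<sigma>
     then - \<beta> * \<sigma> powr (- \<beta> - 1) + \<beta> * (\<beta> + 1) * \<sigma> powr (- \<beta> - 2) * (s - \<sigma>)
     else - \<beta> * s powr (- \<beta> - 1))"

text \<open>The form with \<open>max\<close> makes the continuity at \<open>s = \<sigma>\<close>
  evident; it is there because the Taylor match is of second order.\<close>

definition trunc_pow_deriv2 :: "real \<Rightarrow> real \<Rightarrow> real \<Rightarrow> real" where
  "trunc_pow_deriv2 \<beta> \<sigma> s = \<beta> * (\<beta> + 1) * max s \<sigma> powr (- \<beta> - 2)"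

text \<open>These values do not depend on \<sigma>. Hence the difference of two truncations vanishes
  beyond the larger parameter together with its derivatives, and is a compactly supported test
  function.\<close>

lemma trunc_pow_outside:
  assumes "\<sigma> \<le> s"
  shows "trunc_pow \<beta> \<sigma> s = s powr - \<beta>"
    and "trunc_pow_deriv \<beta> \<sigma> s = - \<beta> * s powr (- \<beta> - 1)"
    and "trunc_pow_deriv2 \<beta> \<sigma> s = \<beta> * (\<beta> + 1) * s powr (- \<beta> - 2)"
  using assms by (auto simp: trunc_pow_def trunc_pow_deriv_def trunc_pow_deriv2_def max_def)

lemma has_real_derivative_trunc_pow:
  assumes "\<sigma> > 0"
  shows "(trunc_pow \<beta> \<sigma> has_real_derivative trunc_pow_deriv \<beta> \<sigma> s) (at s)"
  unfolding trunc_pow_def[abs_def] trunc_pow_deriv_def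
  by (rule has_real_derivative_glue)
    (use assms in \<open>auto intro!: derivative_eq_intros simp: powr_diff field_simps\<close>)

lemma has_real_derivative_trunc_pow_deriv:
  assumes "\<sigma> > 0"
  shows "(trunc_pow_deriv \<beta> \<sigma> has_real_derivative trunc_pow_deriv2 \<beta> \<sigma> s) (at s)"
proof -
  have "((\<lambda>s. if s \<le> \<sigma> then - \<beta> * \<sigma> powr (- \<beta> - 1) + \<beta> * (\<beta> + 1) * \<sigma> powr (- \<beta> - 2) * (s - \<sigma>)
     else - \<beta> * s powr (- \<beta> - 1)) has_real_derivative
     (if s \<le> \<sigma> then \<beta> * (\<beta> + 1) * \<sigma> powr (- \<beta> - 2) else \<beta> * (\<beta> + 1) * s powr (- \<beta> - 2))) (at s)"
  proof (rule has_real_derivative_glue)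
    fix t assume "\<sigma> \<le> t"
    then have "((\<lambda>s. - \<beta> * s powr (- \<beta> - 1)) has_real_derivative
        - \<beta> * ((- \<beta> - 1) * t powr (- \<beta> - 1 - 1))) (at t)"
      using assms by (intro DERIV_cmult has_real_derivative_powr) auto
    then show "((\<lambda>s. - \<beta> * s powr (- \<beta> - 1)) has_real_derivative \<beta> * (\<beta> + 1) * t powr (- \<beta> - 2)) (at t)"
      by (simp add: algebra_simps)
  qed (auto intro!: derivative_eq_intros)
  then show ?thesis
    unfolding trunc_pow_deriv_def[abs_def] trunc_pow_deriv2_def
    by (simp add: max_def not_le split: if_splits)
qed

lemma continuous_trunc_pow_deriv2:
  assumes "\<sigma> > 0"
  shows "continuous_on UNIV (trunc_pow_deriv2 \<beta> \<sigma>)"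
  unfolding trunc_pow_deriv2_def[abs_def] using assms
  by (intro continuous_intros) auto

lemma powr_plus_one:
  fixes t :: real
  assumes "t > 0" "a = b + 1"
  shows "t powr a = t powr b * t"
  using assms by (simp add: powr_add)

text \<open>Outside, \<open>s powr - \<beta>\<close> is |x|^(2-N), which is harmonic. Inside, the
  relations \<open>4 (\<beta> + 1) = 2 N\<close> and \<open>2 (\<beta> + 2) = N + 2\<close> collect
  all terms into one multiple of \<open>s - \<sigma>\<close>.\<close>

lemma trunc_pow_laplacian:
  assumes "\<sigma> > 0" and N: "real N = 2 * \<beta> + 2"
  shows "4 * s * trunc_pow_deriv2 \<beta> \<sigma> s + 2 * real N * trunc_pow_deriv \<beta> \<sigma> s =
    - (\<beta> * real N * (real N + 2) * \<sigma> powr (- \<beta> - 2) * max 0 (\<sigma> - s))"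
proof (cases "s \<le> \<sigma>")
  case True
  have "\<sigma> powr (- \<beta> - 1) = \<sigma> powr (- \<beta> - 2) * \<sigma>"
    using assms by (intro powr_plus_one) auto
  then show ?thesis
    using True unfolding trunc_pow_deriv_def trunc_pow_deriv2_def N
    by (simp add: max_def algebra_simps)
next
  case False
  then have "s powr (- \<beta> - 1) = s powr (- \<beta> - 2) * s"
    using assms by (intro powr_plus_one) auto
  then show ?thesis
    using False unfolding trunc_pow_deriv_def trunc_pow_deriv2_def N
    by (simp add: max_def algebra_simps)
qed

text \<open>The derivative of a Taylor polynomial in its base point is its next term.\<close>

lemma trunc_pow_antimono:
  assumes "0 < \<sigma>" "\<sigma> \<le> \<sigma>'" "\<beta> \<ge> 0" "0 \<le> s"
  shows "trunc_pow \<beta> \<sigma>' s \<le> trunc_pow \<beta> \<sigma> s"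
proof -
  \<comment> \<open>\<open>T\<close> is twice the Taylor polynomial as a function of its base
    point.\<close>
  define T where "T = (\<lambda>\<sigma>. 2 * \<sigma> powr - \<beta> - 2 * \<beta> * \<sigma> powr (- \<beta> - 1) * (s - \<sigma>)
          + \<beta> * (\<beta> + 1) * \<sigma> powr (- \<beta> - 2) * (s - \<sigma>)\<^sup>2)"
  have T: "T v \<le> T u" if "0 < u" "u \<le> v" for u v
  proof (rule DERIV_nonpos_imp_nonincreasing[OF that(2)])
    fix t assume "u \<le> t" "t \<le> v"
    then have "t > 0" using that by simp
    then have "(T has_real_derivative - (\<beta> * (\<beta> + 1) * (\<beta> + 2) * t powr (- \<beta> - 3) * (s - t)\<^sup>2)) (at t)"
      unfolding T_def by (auto intro!: derivative_eq_intros simp: algebra_simps)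
    then show "\<exists>y. (T has_real_derivative y) (at t) \<and> y \<le> 0"
      using assms by (intro exI conjI) (auto intro!: mult_nonneg_nonneg)
  qed
  \<comment> \<open>Beyond the truncation the value is \<open>s powr - \<beta>\<close>, the
    polynomial with base point \<open>s\<close> itself; hence the base point
    \<open>max u s\<close>.\<close>
  have tp: "2 * trunc_pow \<beta> u s = T (max u s)" if "0 < u" for u
    using that by (auto simp: trunc_pow_def T_def max_def)
  have "T (max \<sigma>' s) \<le> T (max \<sigma> s)"
    by (rule T) (use assms in auto)
  then show ?thesis
    using tp[of \<sigma>] tp[of \<sigma>'] assms by linarith
qed

text \<open>Testing with the difference of two truncated fundamental solutions compares the means
  of the kernel over balls of different radii; the smaller radius then tends to zero.\<close>

lemma green_kernel_mean_value:
  fixes x y :: "'a::euclidean_space"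
  assumes N: "DIM('a) \<ge> 3"
    and g: "dirichlet_green_kernel \<Sigma> \<mu> D g" "y \<in> D"
    and D: "open D" "closed \<Sigma>" "\<Sigma> \<noteq> {}" "D \<inter> \<Sigma> = {}" "\<mu> \<ge> 0"
    and x: "x \<noteq> y" "0 < \<rho>" "cball x \<rho> \<subseteq> D"
  shows "3 / 4 * (LINT z:ball x (\<rho>/2)|lebesgue. g z y)
           \<le> \<rho> ^ DIM('a) * (measure lborel (ball (0::'a) 1) * g x y)"
proof -
  define n where "n = DIM('a)"
  define \<beta> where "\<beta> = (real n - 2) / 2"
  define K where "K = \<beta> * real n * (real n + 2)"
  define V where "V = measure lborel (ball (0::'a) 1)"
  have \<beta>: "\<beta> > 0" "real n = 2 * \<beta> + 2" using N by (auto simp: \<beta>_def n_def field_simps)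
  have K: "K > 0" using \<beta> by (auto simp: K_def)
  have V: "V > 0" by (simp add: V_def content_ball_pos)
  have gi: "set_integrable lebesgue D (\<lambda>z. g z y)"
    using g by (simp add: dirichlet_green_kernel_def)
  have gb: "set_integrable lebesgue (ball x \<delta>) (\<lambda>z. g z y)" if "\<delta> \<le> \<rho>" for \<delta>
    by (rule set_integrable_subset[OF gi]) (use that x in auto)
  \<comment> \<open>With \<open>\<sigma> = t^2\<close> the Laplacian density has height
    \<open>1 / t ^ n\<close> at the centre, so up to \<open>K\<close> it behaves like a mean over
    the ball of radius \<open>t\<close>. The two bounds that follow compare it with indicators; the
    factor 3/4 is the part of \<open>t^2\<close> that \<open>t^2 - s\<close> retains on the half
    ball.\<close>
  have pw: "(t\<^sup>2) powr (- \<beta> - 2) * t\<^sup>2 = 1 / t ^ n" if "t > 0" for t :: real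
  proof -
    have "(t\<^sup>2) powr (- \<beta> - 2) * t\<^sup>2 = (t\<^sup>2) powr (- \<beta> - 1)"
      using that by (intro powr_plus_one[symmetric]) auto
    also have "\<dots> = t powr (2 * (- \<beta> - 1))"
      using that by (simp add: powr_powr flip: powr_numeral)
    also have "2 * (- \<beta> - 1) = - real n" using \<beta> by simp
    also have "t powr (- real n) = 1 / t ^ n"
      using that by (simp add: powr_minus powr_realpow inverse_eq_divide)
    finally show ?thesis .
  qed
  have upper: "(t\<^sup>2) powr (- \<beta> - 2) * max 0 (t\<^sup>2 - s) \<le> (if s < t\<^sup>2 then 1 / t ^ n else 0)"
    if "t > 0" "s \<ge> 0" for t s :: real
    using pw[OF that(1), symmetric] that by (auto intro!: mult_left_mono)
  have lower: "(if s < (t/2)\<^sup>2 then 3 / 4 / t ^ n else 0) \<le> (t\<^sup>2) powr (- \<beta> - 2) * max 0 (t\<^sup>2 - s)"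
    if "t > 0" "s \<ge> 0" for t s :: real
  proof (cases "s < (t/2)\<^sup>2")
    case True
    then have "(t\<^sup>2) powr (- \<beta> - 2) * (3 / 4 * t\<^sup>2) \<le> (t\<^sup>2) powr (- \<beta> - 2) * max 0 (t\<^sup>2 - s)"
      using that by (intro mult_left_mono) (auto simp: power_divide)
    then show ?thesis
      using pw[OF that(1)] True by (simp add: field_simps)
  qed auto
  define I where "I = (LINT z:ball x (\<rho>/2)|lebesgue. g z y)"
  \<comment> \<open>The test function is the truncation at \<delta> minus the one at \<rho>. It is
    nonnegative at \<open>y\<close>, wherever \<open>y\<close> lies, so the integral against
    \<open>h\<close> is nonnegative, and this is the comparison of the two averages.\<close>
  have A: "3 / 4 * I / \<rho> ^ n \<le> (LINT z:ball x \<delta>|lebesgue. g z y) / \<delta> ^ n"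
    if \<delta>: "0 < \<delta>" "\<delta> \<le> \<rho>" for \<delta>
  proof -
    define h where "h = (\<lambda>z. K * (indicator (ball x \<delta>) z / \<delta> ^ n - 3 / 4 * indicator (ball x (\<rho>/2)) z / \<rho> ^ n))"
    let ?\<psi> = "\<lambda>s. trunc_pow \<beta> (\<delta>\<^sup>2) s - trunc_pow \<beta> (\<rho>\<^sup>2) s"
    let ?\<psi>1 = "\<lambda>s. trunc_pow_deriv \<beta> (\<delta>\<^sup>2) s - trunc_pow_deriv \<beta> (\<rho>\<^sup>2) s"
    let ?\<psi>2 = "\<lambda>s. trunc_pow_deriv2 \<beta> (\<delta>\<^sup>2) s - trunc_pow_deriv2 \<beta> (\<rho>\<^sup>2) s"
    have le2: "\<delta>\<^sup>2 \<le> \<rho>\<^sup>2" using \<delta> by (intro power_mono) auto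
    have h_bound: "\<bar>h z\<bar> \<le> K * (1 / \<delta> ^ n + 3 / 4 / \<rho> ^ n)" for z
    proof -
      have "0 < 1 / \<delta> ^ n" "0 < 3 / 4 / \<rho> ^ n" using \<delta> x by auto
      then have "\<bar>indicator (ball x \<delta>) z / \<delta> ^ n - 3 / 4 * indicator (ball x (\<rho>/2)) z / \<rho> ^ n\<bar>
          \<le> 1 / \<delta> ^ n + 3 / 4 / \<rho> ^ n"
        by (cases "z \<in> ball x \<delta>"; cases "z \<in> ball x (\<rho>/2)"; simp add: abs_le_iff)
      then show ?thesis
        using K by (simp add: h_def abs_mult)
    qed
    have lap: "- (4 * (dist x z)\<^sup>2 * ?\<psi>2 ((dist x z)\<^sup>2) + 2 * real DIM('a) * ?\<psi>1 ((dist x z)\<^sup>2)) \<le> h z" for z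
    proof -
      let ?s = "(dist x z)\<^sup>2"
      have "- (4 * ?s * ?\<psi>2 ?s + 2 * real DIM('a) * ?\<psi>1 ?s) =
         K * ((\<delta>\<^sup>2) powr (- \<beta> - 2) * max 0 (\<delta>\<^sup>2 - ?s) - (\<rho>\<^sup>2) powr (- \<beta> - 2) * max 0 (\<rho>\<^sup>2 - ?s))"
        using trunc_pow_laplacian[of "\<delta>\<^sup>2" n \<beta> ?s] trunc_pow_laplacian[of "\<rho>\<^sup>2" n \<beta> ?s] \<delta> x \<beta>
        unfolding K_def n_def by (simp add: algebra_simps)
      also have "\<dots> \<le> K * ((if ?s < \<delta>\<^sup>2 then 1 / \<delta> ^ n else 0) - (if ?s < (\<rho>/2)\<^sup>2 then 3 / 4 / \<rho> ^ n else 0))"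
        using K \<delta> x by (intro mult_left_mono diff_mono upper lower) auto
      also have "\<dots> = h z"
        using \<delta> x power_mono_iff[of \<delta> "dist x z" 2] power_mono_iff[of "\<rho>/2" "dist x z" 2]
        unfolding h_def by (auto simp: indicator_def not_le[symmetric])
      finally show ?thesis .
    qed
    have "0 \<le> ?\<psi> ((dist x y)\<^sup>2)"
      using trunc_pow_antimono[of "\<delta>\<^sup>2" "\<rho>\<^sup>2" \<beta> "(dist x y)\<^sup>2"] \<delta> \<beta> le2 by simp
    also have "\<dots> \<le> (LINT z:D|lebesgue. g z y * h z)"
    proof (rule green_kernel_radial_test[OF g D, where ?\<psi>1.0 = ?\<psi>1 and ?\<psi>2.0 = ?\<psi>2 and \<rho> = \<rho>])
      show "h \<in> borel_measurable borel" unfolding h_def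
        by (intro borel_measurable_times borel_measurable_diff borel_measurable_divide
            borel_measurable_const borel_measurable_indicator) auto
      show "?\<psi> s \<ge> 0" if "0 \<le> s" for s
        using trunc_pow_antimono[of "\<delta>\<^sup>2" "\<rho>\<^sup>2" \<beta> s] \<delta> \<beta> le2 that by simp
      show "?\<psi> s = 0" "?\<psi>1 s = 0" "?\<psi>2 s = 0" if "\<rho>\<^sup>2 \<le> s" for s
        using that order_trans[OF le2 that] by (simp_all add: trunc_pow_outside)
    qed (use h_bound lap \<delta> x in \<open>auto intro!: derivative_intros has_real_derivative_trunc_pow
       has_real_derivative_trunc_pow_deriv continuous_intros continuous_trunc_pow_deriv2\<close>)
    also have "\<dots> = K * ((LINT z:ball x \<delta>|lebesgue. g z y) / \<delta> ^ n - 3 / 4 * I / \<rho> ^ n)"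
    proof -
      have "(LINT z:D|lebesgue. g z y * h z) =
        (LINT z|lebesgue. K * ((indicator (ball x \<delta>) z *\<^sub>R g z y) / \<delta> ^ n
           - 3 / 4 * (indicator (ball x (\<rho>/2)) z *\<^sub>R g z y) / \<rho> ^ n))"
        unfolding set_lebesgue_integral_def
      proof (rule Bochner_Integration.integral_cong[OF refl])
        fix z
        have "z \<in> ball x \<delta> \<Longrightarrow> z \<in> D" "z \<in> ball x (\<rho>/2) \<Longrightarrow> z \<in> D" using \<delta> x by auto
        then show "indicator D z *\<^sub>R (g z y * h z) = K * ((indicator (ball x \<delta>) z *\<^sub>R g z y) / \<delta> ^ n
           - 3 / 4 * (indicator (ball x (\<rho>/2)) z *\<^sub>R g z y) / \<rho> ^ n)"
          unfolding h_def by (auto simp: indicator_def algebra_simps)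
      qed
      then show ?thesis
        using gb[of \<delta>] gb[of "\<rho>/2"] \<delta> x unfolding I_def set_lebesgue_integral_def set_integrable_def by simp
    qed
    finally show ?thesis using K by (simp add: zero_le_mult_iff)
  qed
  \<comment> \<open>Since \<open>x\<close> is not the pole, the kernel is continuous at
    \<open>x\<close>, and its average over a small enough ball exceeds its value by at most
    \<eta>.\<close>
  have B: "3 / 4 * I / \<rho> ^ n \<le> V * (g x y + \<eta>)" if \<eta>: "\<eta> > 0" for \<eta>
  proof -
    have "x \<in> D" using x by auto
    have "continuous_on (D - {y}) (\<lambda>z. g z y)"
      using g closure_subset[of D] unfolding dirichlet_green_kernel_def
      by (metis Diff_mono continuous_on_subset order_refl)
    then have "isCont (\<lambda>z. g z y) x"
      using D x \<open>x \<in> D\<close> by (simp add: continuous_on_eq_continuous_at open_delete)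
    then obtain d where d: "d > 0" "\<And>z. dist z x < d \<Longrightarrow> dist (g z y) (g x y) < \<eta>"
      using \<eta> unfolding continuous_at_eps_delta by blast
    define \<delta> where "\<delta> = min d \<rho>"
    have \<delta>: "0 < \<delta>" "\<delta> \<le> \<rho>" using d x by (auto simp: \<delta>_def)
    have "(LINT z:ball x \<delta>|lebesgue. g z y) \<le> (LINT z:ball x \<delta>|lebesgue. g x y + \<eta>)"
    proof (rule set_integral_mono[OF gb[OF \<delta>(2)]])
      show "set_integrable lebesgue (ball x \<delta>) (\<lambda>z. g x y + \<eta>)"
        unfolding set_integrable_def
        using lmeasurable_ball[of x \<delta>] by (intro integrable_scaleR_left) (simp add: lmeasurable_iff_integrable)
      fix z assume "z \<in> ball x \<delta>"
      then have "dist z x < d" by (auto simp: \<delta>_def dist_commute)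
      from d(2)[OF this] show "g z y \<le> g x y + \<eta>" by (simp add: dist_real_def)
    qed
    also have "\<dots> = (g x y + \<eta>) * measure lborel (ball x \<delta>)"
      by (simp add: set_lebesgue_integral_def)
    also have "\<dots> = (g x y + \<eta>) * (\<delta> ^ n * V)"
      using \<delta> by (subst content_ball_conv_unit_ball) (auto simp: V_def n_def)
    finally have "(LINT z:ball x \<delta>|lebesgue. g z y) / \<delta> ^ n \<le> V * (g x y + \<eta>)"
      using \<delta> by (simp add: field_simps)
    then show ?thesis using A[OF \<delta>] by simp
  qed
  have "3 / 4 * I / \<rho> ^ n \<le> V * g x y"
  proof (rule field_le_epsilon)
    fix e :: real assume "e > 0"
    moreover have "V * (g x y + e / V) = V * g x y + e"
      using V by (simp add: distrib_left)
    ultimately show "3 / 4 * I / \<rho> ^ n \<le> V * g x y + e"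
      using B[of "e / V"] V by simp
  qed
  then show ?thesis
    using x unfolding I_def V_def n_def by (simp add: field_simps)
qed

section \<open>Lower bounds near the boundary\<close>

text \<open>The second derivative is a hat function on \<open>[0, 2 \<eta>]\<close> of integral 1.\<close>

definition ramp :: "real \<Rightarrow> real \<Rightarrow> real" where
  "ramp \<eta> t = (max 0 t ^ 3 - 2 * max 0 (t - \<eta>) ^ 3 + max 0 (t - 2 * \<eta>) ^ 3) / (6 * \<eta>\<^sup>2)"

definition ramp_deriv :: "real \<Rightarrow> real \<Rightarrow> real" where
  "ramp_deriv \<eta> t = (max 0 t ^ 2 - 2 * max 0 (t - \<eta>) ^ 2 + max 0 (t - 2 * \<eta>) ^ 2) / (2 * \<eta>\<^sup>2)"

definition ramp_deriv2 :: "real \<Rightarrow> real \<Rightarrow> real" where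
  "ramp_deriv2 \<eta> t = (max 0 t - 2 * max 0 (t - \<eta>) + max 0 (t - 2 * \<eta>)) / \<eta>\<^sup>2"

lemma has_real_derivative_ramp: "(ramp \<eta> has_real_derivative ramp_deriv \<eta> t) (at t)"
proof -
  have "((\<lambda>t. max 0 (t - c) ^ 3) has_real_derivative 3 * max 0 (t - c) ^ 2) (at t)" for c :: real
    using has_real_derivative_max_power[of 1 "t - c"] DERIV_shift[of "\<lambda>t. max 0 t ^ 3" _ t "- c"]
    by (simp add: numeral_2_eq_2 numeral_3_eq_3 del: power_Suc)
  from this[of 0] this[of \<eta>] this[of "2 * \<eta>"]
  have "(ramp \<eta> has_real_derivative
     (3 * max 0 t ^ 2 - 2 * (3 * max 0 (t - \<eta>) ^ 2) + 3 * max 0 (t - 2 * \<eta>) ^ 2) / (6 * \<eta>\<^sup>2)) (at t)"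
    unfolding ramp_def[abs_def]
    by (intro DERIV_cdivide DERIV_add DERIV_diff DERIV_cmult) auto
  then show ?thesis
    by (rule DERIV_cong) (cases "\<eta> = 0"; simp add: ramp_deriv_def field_simps)
qed

lemma has_real_derivative_ramp_deriv:
  "(ramp_deriv \<eta> has_real_derivative ramp_deriv2 \<eta> t) (at t)"
proof -
  have "((\<lambda>t. max 0 (t - c) ^ 2) has_real_derivative 2 * max 0 (t - c)) (at t)" for c :: real
    using has_real_derivative_max_power[of 0 "t - c"] DERIV_shift[of "\<lambda>t. max 0 t ^ 2" _ t "- c"]
    by (simp add: numeral_2_eq_2 del: power_Suc)
  from this[of 0] this[of \<eta>] this[of "2 * \<eta>"]
  have "(ramp_deriv \<eta> has_real_derivative
     (2 * max 0 t - 2 * (2 * max 0 (t - \<eta>)) + 2 * max 0 (t - 2 * \<eta>)) / (2 * \<eta>\<^sup>2)) (at t)"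
    unfolding ramp_deriv_def[abs_def]
    by (intro DERIV_cdivide DERIV_add DERIV_diff DERIV_cmult) auto
  then show ?thesis
    by (rule DERIV_cong) (cases "\<eta> = 0"; simp add: ramp_deriv2_def field_simps)
qed

lemma continuous_ramp_deriv2: "continuous_on UNIV (ramp_deriv2 \<eta>)"
  unfolding ramp_deriv2_def[abs_def] divide_inverse by (intro continuous_intros)

lemma ramp_eq_0:
  assumes "\<eta> > 0" "t \<le> 0"
  shows "ramp \<eta> t = 0" "ramp_deriv \<eta> t = 0" "ramp_deriv2 \<eta> t = 0"
  using assms by (auto simp: ramp_def ramp_deriv_def ramp_deriv2_def max_def)

lemma ramp_linear:
  assumes "\<eta> > 0" "t \<ge> 2 * \<eta>"
  shows "ramp \<eta> t = t - \<eta>" "ramp_deriv \<eta> t = 1"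
  using assms by (auto simp: ramp_def ramp_deriv_def max_def field_simps power2_eq_square power3_eq_cube)

lemma ramp_deriv2_nonneg: "\<eta> > 0 \<Longrightarrow> 0 \<le> ramp_deriv2 \<eta> t"
  by (auto simp: ramp_deriv2_def max_def)

lemma ramp_deriv_mono: "\<eta> > 0 \<Longrightarrow> s \<le> t \<Longrightarrow> ramp_deriv \<eta> s \<le> ramp_deriv \<eta> t"
  using has_real_derivative_ramp_deriv ramp_deriv2_nonneg
  by (meson DERIV_nonneg_imp_nondecreasing)

text \<open>The derivative is nondecreasing, equals 0 on the negative half-line and 1 beyond
  \<open>2 * \<eta>\<close>.\<close>

lemma ramp_deriv_bounds:
  assumes "\<eta> > 0"
  shows "0 \<le> ramp_deriv \<eta> t" "ramp_deriv \<eta> t \<le> 1"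
  using ramp_deriv_mono[OF assms, of "min 0 t" t] ramp_eq_0[OF assms, of "min 0 t"]
    ramp_deriv_mono[OF assms, of t "max (2 * \<eta>) t"] ramp_linear[OF assms, of "max (2 * \<eta>) t"]
  by auto

lemma ramp_nonneg:
  assumes "\<eta> > 0"
  shows "0 \<le> ramp \<eta> t"
proof -
  have "ramp \<eta> (min 0 t) \<le> ramp \<eta> t"
    by (rule DERIV_nonneg_imp_nondecreasing)
      (use has_real_derivative_ramp ramp_deriv_bounds[OF assms] in auto)
  then show ?thesis
    using ramp_eq_0[OF assms, of "min 0 t"] by simp
qed

text \<open>Hopf's barrier \<open>exp (- A |x - c|\<^sup>2)\<close> is subharmonic away from the centre; its positive part
  above the level of the sphere of radius \<open>r - \<epsilon>\<close> is smoothed by \<open>ramp\<close>.\<close>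

lemma green_kernel_hopf:
  fixes c y :: "'a::euclidean_space"
  assumes g: "dirichlet_green_kernel \<Sigma> \<mu> D g" "y \<in> D"
    and D: "open D" "closed \<Sigma>" "\<Sigma> \<noteq> {}" "D \<inter> \<Sigma> = {}" "\<mu> \<ge> 0"
    and \<epsilon>: "0 < \<epsilon>" "3 * \<epsilon> \<le> r" "cball c (r - \<epsilon>) \<subseteq> D" "dist c y = r - 2 * \<epsilon>"
  shows "exp (- 8 * real DIM('a)) * \<epsilon> * r \<le> 3 * real DIM('a) * (LINT z:ball c (r/4)|lebesgue. g z y)"
proof -
  define n where "n = real DIM('a)"
  have n: "n \<ge> 1" by (simp add: n_def Suc_leI)
  \<comment> \<open>This is the least \<open>A\<close> for which \<open>n - 2 * A * s / r^2\<close>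
    is nonpositive at \<open>s = (r/4)^2\<close>, so that the barrier is subharmonic outside the
    ball of radius \<open>r/4\<close>.\<close>
  define A where "A = 8 * n"
  have A: "A > 0" using n by (simp add: A_def)
  have r: "r > 0" using \<epsilon> by simp
  define e where "e = (\<lambda>s. exp (- (A / r\<^sup>2) * s))"
  define E where "E = (\<lambda>s. e s - e ((r - \<epsilon>)\<^sup>2))"
  \<comment> \<open>\<open>T\<close> will bound \<open>E\<close> from below at the pole. With \<eta>
    a third of it, the pole lies in the range where \<open>ramp\<close> is linear, and the test
    function is at least \<open>2 * T / 3\<close> there.\<close>
  define T where "T = exp (- A) * A * \<epsilon> / r"
  define \<eta> where "\<eta> = T / 3"
  have \<eta>: "\<eta> > 0" using A r \<epsilon> by (simp add: \<eta>_def T_def)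
  let ?\<psi> = "\<lambda>s. ramp \<eta> (E s)"
  let ?\<psi>1 = "\<lambda>s. ramp_deriv \<eta> (E s) * (- (A / r\<^sup>2) * e s)"
  let ?\<psi>2 = "\<lambda>s. ramp_deriv2 \<eta> (E s) * (- (A / r\<^sup>2) * e s)\<^sup>2 + ramp_deriv \<eta> (E s) * ((A / r\<^sup>2)\<^sup>2 * e s)"
  define h :: "'a \<Rightarrow> real" where "h = (\<lambda>z. 2 * A * n / r\<^sup>2 * indicator (ball c (r/4)) z)"
  have "((\<lambda>s. exp (b * s)) has_real_derivative b * exp (b * s)) (at s)" for b s :: real
    by (auto intro!: derivative_eq_intros)
  then have de: "(e has_real_derivative (- (A / r\<^sup>2) * e s)) (at s)" for s
    unfolding e_def .
  then have dE: "(E has_real_derivative (- (A / r\<^sup>2) * e s)) (at s)" for s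
    unfolding E_def by (auto intro!: derivative_eq_intros)
  have E0: "E s \<le> 0" if "(r - \<epsilon>)\<^sup>2 \<le> s" for s
    using that A r by (simp add: E_def e_def divide_right_mono mult_left_mono)
  have 1: "(?\<psi> has_real_derivative ?\<psi>1 s) (at s)" for s
    using DERIV_chain2[OF has_real_derivative_ramp dE] .
  have 2: "(?\<psi>1 has_real_derivative ?\<psi>2 s) (at s)" for s
    using DERIV_mult[OF DERIV_chain2[OF has_real_derivative_ramp_deriv dE] DERIV_cmult[OF de]]
    by (rule DERIV_cong) (simp add: power2_eq_square mult_ac)
  have ce: "continuous_on UNIV e" unfolding e_def by (intro continuous_intros)
  have cE: "continuous_on UNIV E" unfolding E_def by (intro continuous_intros ce)
  have crd: "continuous_on UNIV (ramp_deriv \<eta>)"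
    by (rule DERIV_continuous_on[OF has_field_derivative_at_within[OF has_real_derivative_ramp_deriv]])
  have "continuous_on UNIV (\<lambda>s. ramp_deriv2 \<eta> (E s))" "continuous_on UNIV (\<lambda>s. ramp_deriv \<eta> (E s))"
    by (rule continuous_on_compose2[OF continuous_ramp_deriv2 cE] continuous_on_compose2[OF crd cE]; simp)+
  then have 3: "continuous_on UNIV ?\<psi>2"
    by (intro continuous_on_add continuous_on_mult continuous_on_power continuous_on_const ce)
  have lap: "- (4 * (dist c x)\<^sup>2 * ?\<psi>2 ((dist c x)\<^sup>2) + 2 * n * ?\<psi>1 ((dist c x)\<^sup>2)) \<le> h x" for x
  proof -
    let ?s = "(dist c x)\<^sup>2"
    have e: "0 < e ?s" "e ?s \<le> 1" using A by (auto simp: e_def)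
    \<comment> \<open>By convexity of \<open>ramp\<close>, the smoothing contributes a term of
      favourable sign to minus the Laplacian.\<close>
    have "0 \<le> 4 * ?s * (ramp_deriv2 \<eta> (E ?s) * (- (A / r\<^sup>2) * e ?s)\<^sup>2)"
      using ramp_deriv2_nonneg[OF \<eta>] by simp
    then have "- (4 * ?s * ?\<psi>2 ?s + 2 * n * ?\<psi>1 ?s) \<le> ramp_deriv \<eta> (E ?s) * (2 * A / r\<^sup>2 * e ?s * (n - 2 * A * ?s / r\<^sup>2))"
      by (simp add: algebra_simps power2_eq_square)
    also have "\<dots> \<le> h x"
    proof (cases "x \<in> ball c (r/4)")
      case True
      have "0 \<le> A * (2 * ?s) / r\<^sup>2" using A by simp
      then have "ramp_deriv \<eta> (E ?s) * (2 * A / r\<^sup>2 * e ?s * (n - 2 * A * ?s / r\<^sup>2))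
          \<le> ramp_deriv \<eta> (E ?s) * (2 * A / r\<^sup>2 * e ?s * n)"
        using A e ramp_deriv_bounds[OF \<eta>] by (intro mult_left_mono) auto
      also have "\<dots> \<le> 1 * (2 * A / r\<^sup>2 * 1 * n)"
      proof (rule mult_mono)
        show "2 * A / r\<^sup>2 * e ?s * n \<le> 2 * A / r\<^sup>2 * 1 * n"
          using A e n by (intro mult_right_mono mult_left_mono) auto
      qed (use A e n ramp_deriv_bounds[OF \<eta>] in auto)
      finally show ?thesis using True by (simp add: h_def)
    next
      case False
      then have "(r/4)\<^sup>2 \<le> ?s" using r by (intro power_mono) auto
      then have "n - 2 * A * ?s / r\<^sup>2 \<le> 0"
        using r n by (simp add: A_def field_simps power_divide)
      then have "ramp_deriv \<eta> (E ?s) * (2 * A / r\<^sup>2 * e ?s * (n - 2 * A * ?s / r\<^sup>2)) \<le> 0"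
        using A e ramp_deriv_bounds[OF \<eta>] by (intro mult_nonneg_nonpos) auto
      then show ?thesis
        using False by (simp add: h_def)
    qed
    finally show ?thesis .
  qed
  have "?\<psi> ((dist c y)\<^sup>2) \<le> (LINT z:D|lebesgue. g z y * h z)"
  proof (rule green_kernel_radial_test[OF g D 1 2 3, where \<rho> = "r - \<epsilon>"])
    show "h \<in> borel_measurable borel" unfolding h_def
      by (intro borel_measurable_times borel_measurable_const borel_measurable_indicator) auto
    show "\<bar>h z\<bar> \<le> 2 * A * n / r\<^sup>2" for z using A n by (auto simp: h_def indicator_def)
    show "?\<psi> s = 0" "?\<psi>1 s = 0" "?\<psi>2 s = 0" if "(r - \<epsilon>)\<^sup>2 \<le> s" for s
      using ramp_eq_0[OF \<eta> E0[OF that]] by simp_all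
    show "0 \<le> ?\<psi> s" for s by (rule ramp_nonneg[OF \<eta>])
  qed (use lap[unfolded n_def] \<epsilon> in simp_all)
  also have "(LINT z:D|lebesgue. g z y * h z) = 2 * A * n / r\<^sup>2 * (LINT z:ball c (r/4)|lebesgue. g z y)"
  proof -
    have "ball c (r/4) \<subseteq> D" using \<epsilon> by (intro order_trans[OF _ \<epsilon>(3)]) auto
    then have "(LINT z:D|lebesgue. g z y * h z) = (LINT z:ball c (r/4)|lebesgue. 2 * A * n / r\<^sup>2 * g z y)"
      unfolding set_lebesgue_integral_def h_def
      by (intro Bochner_Integration.integral_cong) (auto simp: indicator_def)
    then show ?thesis by simp
  qed
  finally have main: "?\<psi> ((dist c y)\<^sup>2) \<le> 2 * A * n / r\<^sup>2 * (LINT z:ball c (r/4)|lebesgue. g z y)" .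
  \<comment> \<open>The exponents of the barrier on the sphere through \<open>y\<close> and on the
    edge of the support. The gap \<open>b - a\<close> is at least \<open>A * \<epsilon> / r\<close>,
    and \<open>b \<le> A\<close> keeps the factor \<open>exp (- b)\<close> away from 0.\<close>
  define a b where "a = A / r\<^sup>2 * (r - 2 * \<epsilon>)\<^sup>2" and "b = A / r\<^sup>2 * (r - \<epsilon>)\<^sup>2"
  have "(r - \<epsilon>)\<^sup>2 \<le> r\<^sup>2" using \<epsilon> by (intro power_mono) auto
  then have bA: "b \<le> A" using A r by (simp add: b_def field_simps)
  have "A * \<epsilon> / r = A / r\<^sup>2 * (\<epsilon> * r)" using r by (simp add: power2_eq_square)
  also have "\<dots> \<le> A / r\<^sup>2 * ((r - \<epsilon>)\<^sup>2 - (r - 2 * \<epsilon>)\<^sup>2)"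
  proof (rule mult_left_mono)
    have "\<epsilon> * r \<le> \<epsilon> * (2 * r - 3 * \<epsilon>)" using \<epsilon> by (intro mult_left_mono) auto
    also have "\<dots> = (r - \<epsilon>)\<^sup>2 - (r - 2 * \<epsilon>)\<^sup>2" by (simp add: power2_eq_square algebra_simps)
    finally show "\<epsilon> * r \<le> (r - \<epsilon>)\<^sup>2 - (r - 2 * \<epsilon>)\<^sup>2" .
  qed (use A in auto)
  finally have ba: "A * \<epsilon> / r \<le> b - a" by (simp add: a_def b_def algebra_simps)
  have "A * \<epsilon> / r \<le> exp (b - a) - 1"
    using ba exp_ge_add_one_self[of "b - a"] by linarith
  have "T = exp (- A) * (A * \<epsilon> / r)" by (simp add: T_def)
  also have "\<dots> \<le> exp (- b) * (exp (b - a) - 1)"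
    using \<open>A * \<epsilon> / r \<le> exp (b - a) - 1\<close> bA A r \<epsilon> by (intro mult_mono) auto
  also have "\<dots> = exp (- a) - exp (- b)" by (simp add: algebra_simps flip: exp_add)
  also have "\<dots> = E ((dist c y)\<^sup>2)"
    unfolding E_def e_def a_def b_def \<epsilon>(4) by simp
  finally have TE: "T \<le> E ((dist c y)\<^sup>2)" .
  then have "2 * T / 3 \<le> ?\<psi> ((dist c y)\<^sup>2)"
    using \<eta> ramp_linear(1)[OF \<eta>, of "E ((dist c y)\<^sup>2)"] by (simp add: \<eta>_def)
  with main have "2 * T / 3 \<le> 2 * A * n / r\<^sup>2 * (LINT z:ball c (r/4)|lebesgue. g z y)" by linarith
  then show ?thesis
    using A r unfolding T_def by (simp add: A_def n_def field_simps power2_eq_square)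
qed

section \<open>Passage from the exhaustion to the limit kernel\<close>

lemma smooth_exhaustion_compact:
  assumes "smooth_exhaustion W D" "compact K" "K \<subseteq> W"
  obtains n0 where "\<And>n. n \<ge> n0 \<Longrightarrow> K \<subseteq> D n"
proof -
  have op: "open (D n)" for n
    using assms(1) unfolding smooth_exhaustion_def bounded_Ck_domain_def by blast
  have "D n \<subseteq> D (Suc n)" for n
    using assms(1) closure_subset unfolding smooth_exhaustion_def by blast
  then have mono: "m \<le> n \<Longrightarrow> D m \<subseteq> D n" for m n
    by (rule lift_Suc_mono_le)
  have "K \<subseteq> (\<Union>n\<in>UNIV. D n)"
    using assms unfolding smooth_exhaustion_def by simp
  then obtain F where F: "finite F" "K \<subseteq> (\<Union>n\<in>F. D n)"
    using compactE_image[OF assms(2), of UNIV D] op by metis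
  show ?thesis
  proof
    fix n assume "n \<ge> Max (insert 0 F)"
    then have "m \<le> n" if "m \<in> F" for m using F(1) that by auto
    then show "K \<subseteq> D n" using F(2) mono by blast
  qed
qed

text \<open>Hopf's barrier bounds the integral of the kernel over the ball of radius
  \<open>r/4\<close> about \<open>c\<close> from below by a multiple of
  \<open>\<epsilon> * r\<close>. That ball lies in the ball of radius \<open>3 * r / 8\<close> about
  \<open>x\<close>, where the super-mean-value inequality turns the integral into the value at
  \<open>x\<close>. The constant does not depend on the exhausting domain, so the bound passes to
  the limit.\<close>

lemma green_kernel_lower_bound:
  fixes G :: "'a::euclidean_space \<Rightarrow> 'a \<Rightarrow> ennreal"
  assumes N: "DIM('a) \<ge> 3"
    and G: "green_kernel \<Omega> \<Sigma> \<mu> G" and \<Sigma>: "closed \<Sigma>" "\<Sigma> \<noteq> {}" and \<mu>: "\<mu> \<ge> 0"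
  obtains \<kappa> where "\<kappa> > 0"
    and "\<And>c r \<epsilon> x y. 0 < \<epsilon> \<Longrightarrow> 8 * \<epsilon> \<le> r \<Longrightarrow> cball c (r - \<epsilon>) \<subseteq> \<Omega> - \<Sigma> \<Longrightarrow>
       dist c y = r - 2 * \<epsilon> \<Longrightarrow> dist c x < r / 8 \<Longrightarrow> ennreal (\<kappa> * \<epsilon> * r / r ^ DIM('a)) \<le> G x y"
proof -
  define n where "n = DIM('a)"
  define V where "V = measure lborel (ball (0::'a) 1)"
  have V: "V > 0" by (simp add: V_def content_ball_pos)
  have n: "n \<ge> 3" using N by (simp add: n_def)
  \<comment> \<open>The denominator is \<open>3 * n\<close> from the barrier times
    \<open>4/3 * (3/4) ^ n * V\<close> from the mean value inequality at radius
    \<open>3 * r / 4\<close>.\<close>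
  define \<kappa> where "\<kappa> = exp (- 8 * real n) / (4 * real n * (3 / 4) ^ n * V)"
  have "\<kappa> > 0" using V n by (simp add: \<kappa>_def)
  moreover have "ennreal (\<kappa> * \<epsilon> * r / r ^ n) \<le> G x y"
    if \<epsilon>: "0 < \<epsilon>" "8 * \<epsilon> \<le> r" and sub: "cball c (r - \<epsilon>) \<subseteq> \<Omega> - \<Sigma>"
      and y: "dist c y = r - 2 * \<epsilon>" and x: "dist c x < r / 8" for c r \<epsilon> x y
  proof -
    obtain D g where D: "smooth_exhaustion (\<Omega> - \<Sigma>) D"
      and g: "\<And>m. dirichlet_green_kernel \<Sigma> \<mu> (D m) (g m)"
      and lim: "\<And>x y. x \<in> \<Omega> - \<Sigma> \<Longrightarrow> y \<in> \<Omega> - \<Sigma> \<Longrightarrow> x \<noteq> y \<Longrightarrow> (\<lambda>m. ennreal (g m x y)) \<longlonglongrightarrow> G x y"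
      using G unfolding green_kernel_def by blast
    have r: "r > 0" using \<epsilon> by simp
    \<comment> \<open>The pole stays outside the ball of radius \<open>3 * r / 8\<close> about
      \<open>x\<close>, so the kernel is nonnegative on all of that ball.\<close>
    have yx: "5 * r / 8 < dist y x"
      using dist_triangle[of c y x] x y \<epsilon> by (simp add: dist_commute)
    obtain m0 where m0: "\<And>m. m \<ge> m0 \<Longrightarrow> cball c (r - \<epsilon>) \<subseteq> D m"
      using smooth_exhaustion_compact[OF D _ sub] by auto
    have "\<kappa> * \<epsilon> * r / r ^ n \<le> g m x y" if "m \<ge> m0" for m
    proof -
      note sm = m0[OF that]
      have y_in: "y \<in> D m" using sm y \<epsilon> by auto
      have op: "open (D m)"
        using D unfolding smooth_exhaustion_def bounded_Ck_domain_def by blast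
      have disj: "D m \<inter> \<Sigma> = {}" using D unfolding smooth_exhaustion_def by blast
      have in_cball: "cball x (3 * r / 4) \<subseteq> cball c (r - \<epsilon>)"
      proof
        fix z assume "z \<in> cball x (3 * r / 4)"
        then show "z \<in> cball c (r - \<epsilon>)" using dist_triangle[of c z x] x \<epsilon> by auto
      qed
      have subs: "ball c (r / 4) \<subseteq> ball x (3 * r / 4 / 2)"
      proof
        fix z assume "z \<in> ball c (r / 4)"
        then show "z \<in> ball x (3 * r / 4 / 2)"
          using dist_triangle[of x z c] x by (auto simp: dist_commute)
      qed
      have gi: "set_integrable lebesgue (D m) (\<lambda>z. g m z y)"
        using g[of m] y_in by (simp add: dirichlet_green_kernel_def)
      have in_D: "ball x (3 * r / 4 / 2) \<subseteq> D m"
      proof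
        fix z assume "z \<in> ball x (3 * r / 4 / 2)"
        then have "z \<in> cball x (3 * r / 4)" using r by auto
        then show "z \<in> D m" using in_cball sm by blast
      qed
      have "(LINT z:ball c (r/4)|lebesgue. g m z y) \<le> (LINT z:ball x (3 * r / 4 / 2)|lebesgue. g m z y)"
        unfolding set_lebesgue_integral_def
      proof (rule integral_mono)
        show "integrable lebesgue (\<lambda>z. indicator (ball c (r/4)) z *\<^sub>R g m z y)"
          using set_integrable_subset[OF gi, of "ball c (r/4)"] subs in_D
          unfolding set_integrable_def by (simp add: order_trans)
        show "integrable lebesgue (\<lambda>z. indicator (ball x (3 * r / 4 / 2)) z *\<^sub>R g m z y)"
          using set_integrable_subset[OF gi, of "ball x (3 * r / 4 / 2)"] in_D
          unfolding set_integrable_def by simp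
        fix z
        have "0 \<le> g m z y" if "z \<in> ball x (3 * r / 4 / 2)"
        proof -
          have "z \<noteq> y" using that yx r by (auto simp: dist_commute)
          then show ?thesis
            using g[of m] y_in in_D that unfolding dirichlet_green_kernel_def by blast
        qed
        then show "indicator (ball c (r/4)) z *\<^sub>R g m z y \<le> indicator (ball x (3 * r / 4 / 2)) z *\<^sub>R g m z y"
          using subs by (auto simp: indicator_def)
      qed
      also have "3 / 4 * \<dots> \<le> (3 * r / 4) ^ n * (V * g m x y)"
        unfolding n_def V_def
        by (rule green_kernel_mean_value[OF N g y_in op \<Sigma> disj \<mu>])
          (use yx r in_cball sm in auto)
      finally have I: "(LINT z:ball c (r/4)|lebesgue. g m z y) \<le> 4 / 3 * ((3 * r / 4) ^ n * (V * g m x y))"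
        by simp
      have "exp (- 8 * real n) * \<epsilon> * r \<le> 3 * real n * (LINT z:ball c (r/4)|lebesgue. g m z y)"
        unfolding n_def
        by (rule green_kernel_hopf[OF g y_in op \<Sigma> disj \<mu> \<epsilon>(1) _ sm y]) (use \<epsilon> in auto)
      also have "\<dots> \<le> 3 * real n * (4 / 3 * ((3 * r / 4) ^ n * (V * g m x y)))"
        using I by (intro mult_left_mono) auto
      also have "\<dots> = (4 * real n * (3 / 4) ^ n * V) * (r ^ n * g m x y)"
        by (simp add: power_divide power_mult_distrib)
      finally have "\<kappa> * \<epsilon> * r \<le> r ^ n * g m x y"
        using V n unfolding \<kappa>_def by (simp add: field_simps)
      then show ?thesis using r by (simp add: field_simps)
    qed
    then have "\<forall>m\<ge>m0. ennreal (\<kappa> * \<epsilon> * r / r ^ n) \<le> ennreal (g m x y)"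
      by (simp add: ennreal_leI)
    moreover have "x \<in> cball c (r - \<epsilon>)" "y \<in> cball c (r - \<epsilon>)" "x \<noteq> y"
      using x y \<epsilon> yx r by auto
    then have "x \<in> \<Omega> - \<Sigma>" "y \<in> \<Omega> - \<Sigma>" "x \<noteq> y"
      using sub by auto
    ultimately show ?thesis
      using LIMSEQ_le_const[OF lim] by blast
  qed
  ultimately show thesis
    using that unfolding n_def by blast
qed

section \<open>Concentration of the measure at the boundary\<close>

text \<open>The measure is the sum of Dirac masses at \<open>y n\<close> with weights
  \<open>(1/2) ^ Suc n / \<phi> (y n)\<close>, built as the image under \<open>y\<close> of a
  weighted counting measure. It is finite on compact subsets of \<open>W\<close> because the points
  converge to \<open>z\<close> outside \<open>W\<close>, so only finitely many indices fall into
  each.\<close>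

lemma exists_weighted_discrete_measure:
  fixes y :: "nat \<Rightarrow> 'a::euclidean_space"
  assumes y: "\<And>n. y n \<in> W" "y \<longlonglongrightarrow> z" "z \<notin> W"
    and \<phi>: "continuous_on W \<phi>" "\<And>x. x \<in> W \<Longrightarrow> \<phi> x > 0"
  obtains \<tau> where "radon_measure_on W \<tau>" "weighted_mass \<phi> \<tau> = 1"
    and "\<And>n f. ennreal ((1/2) ^ Suc n / \<phi> (y n)) * f (y n) \<le> (\<integral>\<^sup>+ x. f x \<partial>\<tau>)"
proof -
  define a where "a = (\<lambda>n. (1/2::real) ^ Suc n / \<phi> (y n))"
  define \<nu> where "\<nu> = density (count_space UNIV) (\<lambda>n. ennreal (a n))"
  define \<tau> where "\<tau> = distr \<nu> (restrict_space borel W) y"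
  have ym: "y \<in> measurable \<nu> (restrict_space borel W)"
    using y(1) by (simp add: \<nu>_def measurable_def space_restrict_space)
  have sp: "space \<tau> = W" "sets \<tau> = sets (restrict_space borel W)"
    by (auto simp: \<tau>_def space_restrict_space)
  have fin: "emeasure \<tau> K < \<infinity>" if K: "compact K" "K \<subseteq> W" for K
  proof -
    have "open (- K)" "z \<in> - K" using K y compact_imp_closed by blast+
    then have "\<forall>\<^sub>F n in sequentially. y n \<in> - K" by (rule topological_tendstoD[OF y(2)])
    then have f: "finite (y -` K)"
      by (auto simp: eventually_cofinite vimage_def simp flip: cofinite_eq_sequentially)
    have "K \<in> sets (restrict_space borel W)"
      using K compact_imp_closed[OF K(1)] by (auto simp: sets_restrict_space intro!: image_eqI[of _ _ K])
    then have "emeasure \<tau> K = emeasure \<nu> (y -` K)"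
      unfolding \<tau>_def using ym by (subst emeasure_distr) (auto simp: \<nu>_def)
    also have "\<dots> = (\<Sum>n\<in>y -` K. ennreal (a n))"
      using f by (simp add: \<nu>_def emeasure_density nn_integral_count_space_indicator[symmetric]
          nn_integral_count_space_finite mult.commute)
    also have "\<dots> < \<infinity>" using f by (simp add: less_top[symmetric])
    finally show ?thesis .
  qed
  have "weighted_mass \<phi> \<tau> = (\<integral>\<^sup>+ n. ennreal (\<phi> (y n)) \<partial>\<nu>)"
    unfolding weighted_mass_def \<tau>_def
    by (rule nn_integral_distr[OF ym])
      (use borel_measurable_continuous_on_restrict[OF \<phi>(1)] in simp)
  also have "\<dots> = (\<integral>\<^sup>+ n. ennreal (a n) * ennreal (\<phi> (y n)) \<partial>count_space UNIV)"
    unfolding \<nu>_def by (rule nn_integral_density) auto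
  also have "\<dots> = (\<integral>\<^sup>+ n. ennreal ((1/2) ^ Suc n) \<partial>count_space UNIV)"
  proof (rule nn_integral_cong)
    fix n
    have "\<phi> (y n) > 0" using \<phi> y by auto
    then show "ennreal (a n) * ennreal (\<phi> (y n)) = ennreal ((1/2) ^ Suc n)"
      by (simp add: a_def flip: ennreal_mult)
  qed
  also have "\<dots> = 1"
    using sums_unique[OF power_half_series]
    by (subst nn_integral_count_space_nat, subst suminf_ennreal2)
      (auto intro: sums_summable[OF power_half_series])
  finally have mass: "weighted_mass \<phi> \<tau> = 1" .
  have low: "ennreal (a n) * f (y n) \<le> (\<integral>\<^sup>+ x. f x \<partial>\<tau>)" for n f
  proof -
    have s: "{y n} \<in> sets \<tau>"
      using y(1)[of n] by (auto simp: sp sets_restrict_space intro!: image_eqI[of _ _ "{y n}"])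
    have "ennreal (a n) = emeasure \<nu> {n}"
      by (simp add: \<nu>_def emeasure_density nn_integral_count_space_indicator[symmetric]
          nn_integral_count_space_finite)
    \<comment> \<open>Only an inequality, since the points \<open>y n\<close> may coincide.\<close>
    also have "\<dots> \<le> emeasure \<nu> (y -` {y n} \<inter> space \<nu>)"
      by (intro emeasure_mono) (auto simp: \<nu>_def)
    also have "\<dots> = emeasure \<tau> {y n}"
      unfolding \<tau>_def using s sp by (subst emeasure_distr[OF ym]) auto
    finally have "ennreal (a n) * f (y n) \<le> f (y n) * emeasure \<tau> {y n}"
      by (subst mult.commute) (rule mult_left_mono, auto)
    \<comment> \<open>Here \<open>f\<close> may fail to be measurable; comparison with a measurable
      function below it still holds. This allows the Green kernel to be inserted later.\<close>
    also have "\<dots> = (\<integral>\<^sup>+ x. f (y n) * indicator {y n} x \<partial>\<tau>)"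
      using s by (simp add: nn_integral_cmult_indicator)
    also have "\<dots> \<le> (\<integral>\<^sup>+ x. f x \<partial>\<tau>)"
      by (intro nn_integral_mono) (auto simp: indicator_def)
    finally show ?thesis .
  qed
  show thesis
    using that[of \<tau>] sp fin mass low unfolding radon_measure_on_def a_def by blast
qed

text \<open>A ball about \<open>x0\<close> whose radius is the distance to the boundary touches it
  at a nearest point \<open>z\<close>. Taking \<open>x0\<close> much closer to some boundary point
  than that point is to \<Sigma> keeps the ball away from \<Sigma>.\<close>

lemma exists_interior_tangent_ball:
  fixes \<Omega> \<Sigma> :: "'a::euclidean_space set"
  assumes \<Omega>: "open \<Omega>" "bounded \<Omega>" "\<Omega> \<noteq> {}" and \<Sigma>: "compact \<Sigma>" "\<Sigma> \<subseteq> \<Omega>" "\<Sigma> \<noteq> {}"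
  obtains x0 z R m M where "0 < R" "0 < m" "z \<in> frontier \<Omega>" "dist x0 z = R" "ball x0 R \<subseteq> \<Omega> - \<Sigma>"
    and "\<And>x. x \<in> ball x0 R \<Longrightarrow> R - dist x0 x \<le> infdist x (frontier \<Omega>)"
    and "\<And>x. x \<in> ball x0 R \<Longrightarrow> m \<le> infdist x \<Sigma> \<and> infdist x \<Sigma> \<le> M"
proof -
  have "\<Omega> \<noteq> UNIV" using \<Omega>(2) not_bounded_UNIV by blast
  then have fr: "frontier \<Omega> \<noteq> {}" using \<Omega>(3) frontier_eq_empty by blast
  then obtain z' where z': "z' \<in> frontier \<Omega>" by blast
  then have "z' \<notin> \<Sigma>" using \<Omega>(1) \<Sigma>(2) by (auto simp: frontier_def interior_open)
  then have d: "infdist z' \<Sigma> > 0"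
    using \<Sigma> by (metis compact_imp_closed in_closed_iff_infdist_zero infdist_nonneg less_eq_real_def)
  define d where "d = infdist z' \<Sigma>"
  obtain x0 where x0: "x0 \<in> \<Omega>" "dist x0 z' < d / 4"
    using z' d closure_approachable[of z' \<Omega>] unfolding frontier_def d_def
    by (metis DiffD1 divide_pos_pos zero_less_numeral)
  obtain z where z: "z \<in> frontier \<Omega>" "infdist x0 (frontier \<Omega>) = dist x0 z"
    using infdist_attains_inf[OF frontier_closed fr] by blast
  define R where "R = dist x0 z"
  have "x0 \<noteq> z" using x0 z \<Omega>(1) by (auto simp: frontier_def interior_open)
  then have R: "R > 0" by (simp add: R_def)
  have Rd: "R < d / 4"
    using infdist_le[OF z', of x0] z x0 by (simp add: R_def)
  have fd: "R - dist x0 x \<le> infdist x (frontier \<Omega>)" for x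
    using infdist_triangle[of x0 "frontier \<Omega>" x] z by (simp add: R_def dist_commute)
  have sd: "d / 2 \<le> infdist x \<Sigma> \<and> infdist x \<Sigma> \<le> d + d" if "x \<in> ball x0 R" for x
  proof -
    have "dist z' x < d / 2"
      using that Rd x0 dist_triangle[of z' x x0] by (simp add: dist_commute)
    then show ?thesis
      using infdist_triangle[of z' \<Sigma> x] infdist_triangle[of x \<Sigma> z'] by (simp add: d_def dist_commute)
  qed
  have "ball x0 R \<inter> frontier \<Omega> = {}"
    using infdist_le[of _ "frontier \<Omega>" x0] z by (force simp: R_def)
  moreover have meets: "x0 \<in> ball x0 R" "x0 \<in> \<Omega>" using R x0 by auto
  ultimately have sub: "ball x0 R \<subseteq> \<Omega>"
    using connected_Int_frontier[OF connected_ball, of x0 R \<Omega>] meets by blast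
  have "ball x0 R \<inter> \<Sigma> = {}"
    using sd d by (force simp: d_def)
  with sub have int: "ball x0 R \<subseteq> \<Omega> - \<Sigma>" by blast
  show thesis
  proof (rule that[of R "d / 2" z x0 "d + d"])
    show "0 < d / 2" using d by (simp add: d_def)
    show "dist x0 z = R" by (simp add: R_def)
  qed (rule R z(1) int fd sd, assumption?)+
qed

text \<open>Where the distance to \<Sigma> stays between \<open>m\<close> and \<open>M\<close>, its
  power is comparable to a constant and only the distance to the boundary remains. The exponent
  satisfies \<open>\<alpha> \<ge> 0\<close>, which decides that \<open>M\<close> serves the lower
  and \<open>m\<close> the upper bound.\<close>

lemma ground_state_bounds:
  fixes \<Omega> \<Sigma> :: "'a::euclidean_space set"
  assumes \<phi>: "ground_state \<Omega> \<Sigma> k \<mu> \<phi>" and k: "k + 2 < DIM('a)"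
    and \<mu>: "0 \<le> \<mu>" "\<mu> \<le> (hardy_H DIM('a) k)\<^sup>2"
    and B: "B \<subseteq> \<Omega> - \<Sigma>" "0 < m" "\<And>x. x \<in> B \<Longrightarrow> m \<le> infdist x \<Sigma> \<and> infdist x \<Sigma> \<le> M" "B \<noteq> {}"
  obtains a b where "0 < a" "0 < b"
    "\<And>x. x \<in> B \<Longrightarrow> a * infdist x (frontier \<Omega>) \<le> \<phi> x \<and> \<phi> x \<le> b * infdist x (frontier \<Omega>)"
proof -
  define \<alpha> where "\<alpha> = alpha_minus DIM('a) k \<mu>"
  have H: "0 \<le> hardy_H DIM('a) k" using k by (simp add: hardy_H_def)
  have "sqrt ((hardy_H DIM('a) k)\<^sup>2 - \<mu>) \<le> sqrt ((hardy_H DIM('a) k)\<^sup>2)"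
    using \<mu> by (intro real_sqrt_le_mono) auto
  then have \<alpha>: "0 \<le> \<alpha>" using H by (simp add: \<alpha>_def alpha_minus_def)
  obtain c C where c: "c > 0" "C > 0" "\<And>x. x \<in> \<Omega> - \<Sigma> \<Longrightarrow>
      c * (infdist x (frontier \<Omega>) * infdist x \<Sigma> powr - \<alpha>) \<le> \<phi> x \<and>
      \<phi> x \<le> C * (infdist x (frontier \<Omega>) * infdist x \<Sigma> powr - \<alpha>)"
    using \<phi> unfolding ground_state_def Let_def \<alpha>_def by blast
  have mM: "m \<le> M" using B by force
  show thesis
  proof
    show "0 < c * M powr - \<alpha>" "0 < C * m powr - \<alpha>" using c B mM by auto
    fix x assume x: "x \<in> B"
    have p: "M powr - \<alpha> \<le> infdist x \<Sigma> powr - \<alpha>" "infdist x \<Sigma> powr - \<alpha> \<le> m powr - \<alpha>"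
      using B(3)[OF x] B(2) \<alpha> by (auto intro!: powr_mono2')
    have "c * M powr - \<alpha> * infdist x (frontier \<Omega>) \<le> c * (infdist x (frontier \<Omega>) * infdist x \<Sigma> powr - \<alpha>)"
      using mult_left_mono[OF p(1), of "c * infdist x (frontier \<Omega>)"] c by (simp add: mult_ac infdist_nonneg)
    moreover have "C * (infdist x (frontier \<Omega>) * infdist x \<Sigma> powr - \<alpha>) \<le> C * m powr - \<alpha> * infdist x (frontier \<Omega>)"
      using mult_left_mono[OF p(2), of "C * infdist x (frontier \<Omega>)"] c by (simp add: mult_ac infdist_nonneg)
    ultimately show "c * M powr - \<alpha> * infdist x (frontier \<Omega>) \<le> \<phi> x \<and>
       \<phi> x \<le> C * m powr - \<alpha> * infdist x (frontier \<Omega>)"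
      using c(3)[of x] x B(1) by fastforce
  qed
qed

text \<open>At most one indicator is nonzero at \<open>x\<close>.\<close>

lemma sum_disjoint_indicator_le:
  fixes K :: "nat \<Rightarrow> real"
  assumes disj: "disjoint_family_on B {..<J}" and K: "\<And>j. j < J \<Longrightarrow> x \<in> B j \<Longrightarrow> K j \<le> v" and "0 \<le> v"
  shows "(\<Sum>j<J. K j * indicator (B j) x) \<le> v"
proof (cases "\<exists>j<J. x \<in> B j")
  case True
  then obtain j where j: "j < J" "x \<in> B j" by blast
  have "(\<Sum>i<J. K i * indicator (B i) x) = (\<Sum>i\<in>{j}. K i * indicator (B i) x)"
    using j disj by (intro sum.mono_neutral_right) (auto simp: disjoint_family_on_def indicator_def)
  then show ?thesis using j K by simp
next
  case False
  then have "(\<Sum>j<J. K j * indicator (B j) x) = 0" by (intro sum.neutral) auto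
  then show ?thesis using \<open>0 \<le> v\<close> by simp
qed

theorem proposition6p9:
  fixes \<Omega> \<Sigma> :: "'a::euclidean_space set" and k :: nat and \<mu> p :: real
    and \<phi> :: "'a \<Rightarrow> real" and G :: "'a \<Rightarrow> 'a \<Rightarrow> ennreal"
  assumes "DIM('a) \<ge> 3"
    and "bounded_Ck_domain 2 \<Omega>"
    and "compact \<Sigma>" and "\<Sigma> \<subseteq> \<Omega>" and "Ck_submanifold 2 k \<Sigma>"
    and "k + 2 < DIM('a)" and "k = 0 \<longrightarrow> \<Sigma> = {0}"
    and "\<mu> \<le> (hardy_H DIM('a) k)\<^sup>2"
    and "first_eigenvalue \<Omega> \<Sigma> \<mu> > 0"
    and "ground_state \<Omega> \<Sigma> k \<mu> \<phi>"
    and "green_kernel \<Omega> \<Sigma> \<mu> G"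
    and "0 < \<mu>" and "\<mu> < ((real DIM('a) - 2) / 2)\<^sup>2"
    and "p \<ge> (real DIM('a) + 1) / (real DIM('a) - 1)"
  shows "\<exists>\<tau>. radon_measure_on (\<Omega> - \<Sigma>) \<tau> \<and> weighted_mass \<phi> \<tau> = 1 \<and>
           (\<forall>\<rho>>0. \<nexists>u. positive_solution (\<Omega> - \<Sigma>) G \<phi> p \<rho> \<tau> u)"
proof -

  \<comment> \<open>The tangent ball and the bounds inside it\<close>
  define N where "N = DIM('a)"
  define V where "V = measure lborel (ball (0::'a) 1)"
  have V: "V > 0" by (simp add: V_def content_ball_pos)
  have N: "N \<ge> 3" using assms(1) by (simp add: N_def)
  have \<Omega>: "open \<Omega>" "bounded \<Omega>" "\<Omega> \<noteq> {}" using assms(2) by (auto simp: bounded_Ck_domain_def)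
  have \<Sigma>: "closed \<Sigma>" "\<Sigma> \<noteq> {}" using assms(3,5) by (auto simp: compact_imp_closed Ck_submanifold_def)
  have p: "p > 0" "(real N - 1) * p \<ge> real N + 1"
  proof -
    have "0 < (real N + 1) / (real N - 1)" using N by simp
    then show "p > 0" using assms(14) unfolding N_def by linarith
    show "(real N - 1) * p \<ge> real N + 1"
      using assms(14) N unfolding N_def by (simp add: field_simps)
  qed
  obtain x0 z R m M where R: "0 < R" "0 < m" and z: "z \<in> frontier \<Omega>" "dist x0 z = R"
    and ball: "ball x0 R \<subseteq> \<Omega> - \<Sigma>"
    and dist_bd: "\<And>x. x \<in> ball x0 R \<Longrightarrow> R - dist x0 x \<le> infdist x (frontier \<Omega>)"
    and dist_\<Sigma>: "\<And>x. x \<in> ball x0 R \<Longrightarrow> m \<le> infdist x \<Sigma> \<and> infdist x \<Sigma> \<le> M"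
    using exists_interior_tangent_ball[OF \<Omega> assms(3,4) \<Sigma>(2)] by metis
  have "ball x0 R \<noteq> {}" using R by simp
  then obtain a b where ab: "0 < a" "0 < b" and \<phi>_ab: "\<And>x. x \<in> ball x0 R \<Longrightarrow>
      a * infdist x (frontier \<Omega>) \<le> \<phi> x \<and> \<phi> x \<le> b * infdist x (frontier \<Omega>)"
    using ground_state_bounds[OF assms(10,6) less_imp_le[OF assms(12)] assms(8) ball R(2) dist_\<Sigma>] by metis
  have \<phi>_pos: "\<And>x. x \<in> \<Omega> - \<Sigma> \<Longrightarrow> \<phi> x > 0" and "Ck_on 2 (\<Omega> - \<Sigma>) \<phi>"
    using assms(10) unfolding ground_state_def by blast+
  then have \<phi>_cont: "continuous_on (\<Omega> - \<Sigma>) \<phi>"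
    by (auto simp: numeral_2_eq_2 intro!: continuous_at_imp_continuous_on differentiable_imp_continuous_within)
  obtain \<kappa> where \<kappa>: "\<kappa> > 0" and G_low: "\<And>c r \<epsilon> x y. 0 < \<epsilon> \<Longrightarrow> 8 * \<epsilon> \<le> r \<Longrightarrow> cball c (r - \<epsilon>) \<subseteq> \<Omega> - \<Sigma> \<Longrightarrow>
       dist c y = r - 2 * \<epsilon> \<Longrightarrow> dist c x < r / 8 \<Longrightarrow> ennreal (\<kappa> * \<epsilon> * r / r ^ N) \<le> G x y"
    using green_kernel_lower_bound[OF assms(1,11) \<Sigma> less_imp_le[OF assms(12)]] unfolding N_def by metis

  \<comment> \<open>Dyadic balls and poles along the inner normal\<close>
  define e where "e = (x0 - z) /\<^sub>R R"
  have e: "norm e = 1" using z R by (simp add: e_def dist_norm)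
  have x0: "x0 = z + R *\<^sub>R e" using R by (simp add: e_def)
  have d_ray: "dist (z + s *\<^sub>R e) (z + t *\<^sub>R e) = \<bar>s - t\<bar>" for s t
    using e by (simp add: dist_norm flip: scaleR_left_diff_distrib)
  \<comment> \<open>The balls of radius \<open>r j\<close> about \<open>c j\<close> all touch the
    boundary at \<open>z\<close>. Their concentric parts \<open>B j\<close> are disjoint, and in
    each the distance to the boundary is at least \<open>7/8 * r j\<close>.\<close>
  define r where "r = (\<lambda>j::nat. R / 2 ^ j)"
  define c where "c = (\<lambda>j. z + r j *\<^sub>R e)"
  define B where "B = (\<lambda>j. ball (c j) (r j / 8))"
  \<comment> \<open>The number of balls used for the \<open>n\<close>-th pole is large enough to
    beat the weight \<open>(1/2) ^ Suc n\<close> of its Dirac mass, raised to the power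
    \<open>p\<close>, by a factor \<open>Suc n\<close>.\<close>
  define J where "J = (\<lambda>n::nat. nat \<lceil>real (Suc n) * (2 ^ Suc n) powr p\<rceil>)"
  \<comment> \<open>This makes \<open>8 * \<epsilon> n \<le> r j\<close> for all
    \<open>j < J n\<close>, as the kernel bound requires.\<close>
  define \<epsilon> where "\<epsilon> = (\<lambda>n. r (J n) / 8)"
  define y where "y = (\<lambda>n. z + (2 * \<epsilon> n) *\<^sub>R e)"
  have r: "0 < r j" "r j \<le> R" for j
    using R by (auto simp: r_def divide_le_eq mult_le_cancel_left1)
  have r_mono: "r j \<le> r i / 2" if "i < j" for i j
  proof -
    have "(2::real) ^ Suc i \<le> 2 ^ j" using that by (intro power_increasing) auto
    then show ?thesis using R by (simp add: r_def divide_left_mono)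
  qed
  have \<epsilon>: "0 < \<epsilon> n" "8 * \<epsilon> n \<le> R" for n using r by (auto simp: \<epsilon>_def)
  have \<epsilon>_le: "8 * \<epsilon> n \<le> r j" if "j < J n" for n j
    using r_mono[OF that] r(1)[of j] by (simp add: \<epsilon>_def)
  have y_ball: "y n \<in> ball x0 R" for n
    unfolding mem_ball x0 y_def d_ray using \<epsilon>[of n] by simp
  have y_in: "y n \<in> \<Omega> - \<Sigma>" for n using y_ball ball by blast
  have c_x0: "dist x0 (c j) = R - r j" for j
    unfolding c_def x0 d_ray using r[of j] by simp
  have cball_c: "cball (c j) (r j - \<delta>) \<subseteq> ball x0 R" if "\<delta> > 0" for j \<delta>
  proof
    fix x assume "x \<in> cball (c j) (r j - \<delta>)"
    then show "x \<in> ball x0 R" using dist_triangle[of x0 x "c j"] c_x0[of j] that by simp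
  qed
  have B_dist: "7 / 8 * r j \<le> R - dist x0 x" "x \<in> ball x0 R" if "x \<in> B j" for x j
    using that dist_triangle[of x0 x "c j"] c_x0[of j] r[of j] by (auto simp: B_def)
  have \<phi>_low: "7 / 8 * a * r j \<le> \<phi> x" if "x \<in> B j" for x j
  proof -
    have "7 / 8 * r j \<le> infdist x (frontier \<Omega>)"
      using B_dist[OF that] dist_bd[of x] by linarith
    then have "a * (7 / 8 * r j) \<le> a * infdist x (frontier \<Omega>)" using ab by (intro mult_left_mono) auto
    then show ?thesis using \<phi>_ab[OF B_dist(2)[OF that]] by simp
  qed
  have \<phi>_y: "\<phi> (y n) \<le> 2 * b * \<epsilon> n" for n
  proof -
    have "infdist (y n) (frontier \<Omega>) \<le> dist (y n) z" using z by (intro infdist_le)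
    also have "\<dots> = 2 * \<epsilon> n" using d_ray[of "2 * \<epsilon> n" 0] \<epsilon>[of n] by (simp add: y_def)
    finally have "b * infdist (y n) (frontier \<Omega>) \<le> b * (2 * \<epsilon> n)" using ab by (intro mult_left_mono) auto
    then show ?thesis using \<phi>_ab[OF y_ball[of n]] by simp
  qed
  have disj: "disjoint_family_on B I" for I
  proof -
    have *: "B i \<inter> B j = {}" if "i < j" for i j
    proof -
      have "dist z (c i) = r i" "dist z (c j) = r j"
        using d_ray[of 0 "r i"] d_ray[of 0 "r j"] r(1)[of i] r(1)[of j] by (simp_all add: c_def)
      then show ?thesis
        using r_mono[OF that] r(1)[of i] unfolding B_def
        by (intro disjoint_ballI) (use dist_triangle[of z "c i" "c j"] in \<open>simp add: dist_commute\<close>)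
    qed
    show ?thesis unfolding disjoint_family_on_def
      using * by (metis Int_commute linorder_neqE_nat)
  qed
  have J_ge: "real n \<le> real (J n)" for n
  proof -
    have "1 \<le> ((2::real) ^ Suc n) powr p" using p one_le_power[of "2::real" "Suc n"] by (intro ge_one_powr_ge_zero) (simp_all del: power_Suc)
    then have "real (Suc n) * 1 \<le> real (Suc n) * (2 ^ Suc n) powr p" by (intro mult_left_mono) auto
    also have "\<dots> \<le> real (J n)" unfolding J_def by linarith
    finally show ?thesis by simp
  qed
  have y_lim: "y \<longlonglongrightarrow> z"
  proof -
    have "filterlim J at_top sequentially"
      using J_ge by (intro filterlim_at_top_mono[OF filterlim_ident]) auto
    then have "(\<lambda>n. (1/2::real) ^ J n) \<longlonglongrightarrow> 0"
      by (intro filterlim_compose[OF LIMSEQ_power_zero]) auto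
    then have "(\<lambda>n. z + (2 * (R * (1/2) ^ J n / 8)) *\<^sub>R e) \<longlonglongrightarrow> z + (2 * (R * 0 / 8)) *\<^sub>R e"
      by (intro tendsto_intros) auto
    then show ?thesis by (simp add: y_def \<epsilon>_def r_def power_one_over field_simps)
  qed
  have "z \<notin> \<Omega> - \<Sigma>" using z \<Omega>(1) by (auto simp: frontier_def interior_open)
  then obtain \<tau> where \<tau>: "radon_measure_on (\<Omega> - \<Sigma>) \<tau>" "weighted_mass \<phi> \<tau> = 1"
    and \<tau>_low: "\<And>n f. ennreal ((1/2) ^ Suc n / \<phi> (y n)) * f (y n) \<le> (\<integral>\<^sup>+ x. f x \<partial>\<tau>)"
    using exists_weighted_discrete_measure[OF y_in y_lim _ \<phi>_cont \<phi>_pos] by metis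

  \<comment> \<open>Divergence of the weighted integral of a solution\<close>
  have False if \<rho>: "\<rho> > 0" and u: "positive_solution (\<Omega> - \<Sigma>) G \<phi> p \<rho> \<tau> u" for \<rho> u
  proof -
    define I where "I = (LINT x:\<Omega> - \<Sigma>|lebesgue. u x powr p * \<phi> x)"
    \<comment> \<open>The kernel bound carries a factor \<open>\<epsilon> n\<close> and
      \<open>\<phi> (y n)\<close> is at most \<open>2 * b * \<epsilon> n\<close>, so \<epsilon>
      cancels. What is left of \<rho> times the potential of the \<open>n\<close>-th Dirac mass on
      \<open>B j\<close> is \<open>s n\<close> times the power \<open>1 - N\<close> of
      \<open>r j\<close>.\<close>
    define s where "s = (\<lambda>n::nat. \<rho> * \<kappa> / (2 * b) / 2 ^ Suc n)"
    define C where "C = 7 / 8 * a * V / 8 ^ N * R powr (real N + 1 - (real N - 1) * p) * (\<rho> * \<kappa> / (2 * b)) powr p"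
    have C: "C > 0" using ab V R \<rho> \<kappa> by (simp add: C_def)
    have s: "s n > 0" for n using \<rho> \<kappa> ab by (simp add: s_def)
    have u_low: "AE x in lebesgue. x \<in> \<Omega> - \<Sigma> \<longrightarrow> (\<forall>j<J n. x \<in> B j \<longrightarrow> s n * r j / r j ^ N \<le> u x)" for n
    proof -
      have "AE x in lebesgue. x \<in> \<Omega> - \<Sigma> \<longrightarrow> u x > 0"
        "AE x in lebesgue. x \<in> \<Omega> - \<Sigma> \<longrightarrow>
          ennreal (u x) = green_function (\<Omega> - \<Sigma>) G (\<lambda>y. u y powr p) x + ennreal \<rho> * green_measure G \<tau> x"
        using u unfolding positive_solution_def by blast+
      then show ?thesis
      proof eventually_elim
        case (elim x)
        show ?case
        proof (intro impI allI)
          fix j assume x: "x \<in> \<Omega> - \<Sigma>" and j: "j < J n" and xB: "x \<in> B j"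
          have "\<epsilon> n > 0" "\<phi> (y n) > 0" using \<epsilon> \<phi>_pos y_in by auto
          have "s n * r j / r j ^ N = \<rho> * ((1/2) ^ Suc n / (2 * b * \<epsilon> n) * (\<kappa> * \<epsilon> n * r j / r j ^ N))"
            using \<open>\<epsilon> n > 0\<close> ab by (simp add: s_def power_one_over field_simps)
          also have "\<dots> \<le> \<rho> * ((1/2) ^ Suc n / \<phi> (y n) * (\<kappa> * \<epsilon> n * r j / r j ^ N))"
            using \<phi>_y[of n] \<open>\<epsilon> n > 0\<close> \<open>\<phi> (y n) > 0\<close> ab \<rho> \<kappa> r(1)[of j]
            by (intro mult_left_mono mult_right_mono divide_left_mono) auto
          finally have "ennreal (s n * r j / r j ^ N) \<le>
              ennreal (\<rho> * ((1/2) ^ Suc n / \<phi> (y n) * (\<kappa> * \<epsilon> n * r j / r j ^ N)))"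
            by (rule ennreal_leI)
          also have "\<dots> = ennreal \<rho> * (ennreal ((1/2) ^ Suc n / \<phi> (y n)) * ennreal (\<kappa> * \<epsilon> n * r j / r j ^ N))"
            using \<rho> \<open>\<epsilon> n > 0\<close> \<open>\<phi> (y n) > 0\<close> \<kappa> r(1)[of j] by (subst ennreal_mult, simp, simp, subst ennreal_mult) auto
          also have "\<dots> \<le> ennreal \<rho> * (ennreal ((1/2) ^ Suc n / \<phi> (y n)) * G x (y n))"
          proof -
            have "dist (c j) (y n) = r j - 2 * \<epsilon> n"
              unfolding c_def y_def d_ray using \<epsilon>_le[OF j] \<epsilon>(1)[of n] by simp
            then have "ennreal (\<kappa> * \<epsilon> n * r j / r j ^ N) \<le> G x (y n)"
              using \<epsilon>(1) \<epsilon>_le[OF j] cball_c[OF \<epsilon>(1)[of n], of j] ball xB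
              by (intro G_low[where c = "c j"]) (auto simp: B_def)
            then show ?thesis by (intro mult_left_mono) auto
          qed
          also have "\<dots> \<le> ennreal \<rho> * green_measure G \<tau> x"
            unfolding green_measure_def using \<tau>_low by (intro mult_left_mono) auto
          also have "\<dots> \<le> ennreal (u x)"
            using elim x by simp
          \<comment> \<open>\<open>ennreal\<close> sends negative reals to 0, so returning to reals
            takes \<open>u x > 0\<close>.\<close>
          finally show "s n * r j / r j ^ N \<le> u x"
            using elim x by (subst (asm) ennreal_le_iff) auto
        qed
      qed
    qed
    have I_low: "C * real (Suc n) \<le> I" for n
    proof -
      define K where "K = (\<lambda>j. (s n * r j / r j ^ N) powr p * (7 / 8 * a * r j))"
      have K: "0 \<le> K j" for j using s[of n] r(1)[of j] ab by (simp add: K_def)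
      have Bint: "integrable lebesgue (indicator (B j) :: 'a \<Rightarrow> real)" for j
        unfolding B_def using lmeasurable_ball by (simp add: lmeasurable_iff_integrable)
      have "C * s n powr p / (\<rho> * \<kappa> / (2 * b)) powr p \<le> K j * measure lebesgue (B j)" for j
      proof -
        have "measure lebesgue (B j) = (r j / 8) ^ N * V"
          using content_ball_conv_unit_ball[of "r j / 8" "c j"] r(1)[of j] by (simp add: B_def V_def N_def)
        moreover have "(s n * r j / r j ^ N) powr p = s n powr p * r j powr ((1 - real N) * p)"
        proof -
          have "s n * r j / r j ^ N = s n * r j powr (1 - real N)"
            using r(1)[of j] by (simp add: powr_diff powr_realpow)
          then show ?thesis using r(1)[of j] s[of n] by (simp add: powr_mult powr_powr)
        qed
        ultimately have "K j * measure lebesgue (B j) =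
            7 / 8 * a * V / 8 ^ N * s n powr p * (r j powr ((1 - real N) * p) * r j * r j ^ N)"
          by (simp add: K_def power_divide)
        also have "r j powr ((1 - real N) * p) * r j * r j ^ N = r j powr (real N + 1 - (real N - 1) * p)"
        proof -
          have "real N + 1 - (real N - 1) * p = (1 - real N) * p + 1 + real N" by (simp add: algebra_simps)
          then show ?thesis using r(1)[of j] by (simp only: powr_add powr_realpow powr_one)
        qed
        \<comment> \<open>The exponent is nonpositive by the assumption on \<open>p\<close> and
          \<open>r j \<le> R\<close>, so every ball contributes at least the same amount.\<close>
        also have "7 / 8 * a * V / 8 ^ N * s n powr p * \<dots> \<ge>
            7 / 8 * a * V / 8 ^ N * s n powr p * R powr (real N + 1 - (real N - 1) * p)"
          using r[of j] ab V p by (intro mult_left_mono powr_mono2') auto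
        finally show ?thesis
          using \<rho> \<kappa> ab by (simp add: C_def mult_ac)
      qed
      then have "(\<Sum>j<J n. C * s n powr p / (\<rho> * \<kappa> / (2 * b)) powr p) \<le> (\<Sum>j<J n. K j * measure lebesgue (B j))"
        by (intro sum_mono)
      also have "\<dots> = (LINT x|lebesgue. (\<Sum>j<J n. K j * indicator (B j) x))"
        using Bint by (subst Bochner_Integration.integral_sum) auto
      also have "\<dots> \<le> I"
        unfolding I_def set_lebesgue_integral_def
      proof (rule integral_mono_AE)
        show "integrable lebesgue (\<lambda>x. indicator (\<Omega> - \<Sigma>) x *\<^sub>R (u x powr p * \<phi> x))"
          using u by (simp add: positive_solution_def set_integrable_def)
        show "AE x in lebesgue. (\<Sum>j<J n. K j * indicator (B j) x) \<le> indicator (\<Omega> - \<Sigma>) x *\<^sub>R (u x powr p * \<phi> x)"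
          using u_low[of n]
        proof eventually_elim
          case (elim x)
          show ?case
          proof (rule sum_disjoint_indicator_le[OF disj])
            show "0 \<le> indicator (\<Omega> - \<Sigma>) x *\<^sub>R (u x powr p * \<phi> x)"
              using \<phi>_pos[of x] by (auto simp: indicator_def)
            fix j assume j: "j < J n" "x \<in> B j"
            then have x: "x \<in> \<Omega> - \<Sigma>" using B_dist ball by blast
            have "s n * r j / r j ^ N \<le> u x" using elim x j by blast
            then have "K j \<le> u x powr p * \<phi> x"
              unfolding K_def using \<phi>_low[OF j(2)] p s[of n] r(1)[of j] ab
              by (intro mult_mono powr_mono2) auto
            then show "K j \<le> indicator (\<Omega> - \<Sigma>) x *\<^sub>R (u x powr p * \<phi> x)" using x by simp
          qed
        qed
      qed (intro Bochner_Integration.integrable_sum integrable_mult_right Bint)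
      finally have "real (J n) * (C * s n powr p / (\<rho> * \<kappa> / (2 * b)) powr p) \<le> I" by simp
      moreover have "s n powr p / (\<rho> * \<kappa> / (2 * b)) powr p = 1 / (2 ^ Suc n) powr p"
      proof -
        have "0 < \<rho> * \<kappa> / (2 * b)" using \<rho> \<kappa> ab by simp
        moreover have "s n powr p = (\<rho> * \<kappa> / (2 * b)) powr p / (2 ^ Suc n) powr p"
          unfolding s_def by (rule powr_divide)
        ultimately show ?thesis using \<rho> \<kappa> ab by (simp del: power_Suc)
      qed
      then have "C * s n powr p / (\<rho> * \<kappa> / (2 * b)) powr p = C / (2 ^ Suc n) powr p"
        by (metis times_divide_eq_right mult_1_right)
      ultimately have JI: "real (J n) * (C / (2 ^ Suc n) powr p) \<le> I"
        by (simp only:)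
      have "real (Suc n) * (2 ^ Suc n) powr p \<le> real (J n)" unfolding J_def by linarith
      then have "real (Suc n) * (2 ^ Suc n) powr p * (C / (2 ^ Suc n) powr p) \<le> real (J n) * (C / (2 ^ Suc n) powr p)"
        using C by (intro mult_right_mono) auto
      with JI show ?thesis by (simp add: mult.commute del: power_Suc of_nat_Suc)
    qed
    \<comment> \<open>The real number \<open>I\<close> would have to exceed
      \<open>C * real (Suc n)\<close> for every \<open>n\<close>.\<close>
    obtain n :: nat where "I / C < real n" using reals_Archimedean2 by blast
    then have "I < C * real (Suc n)" using C by (simp add: field_simps)
    with I_low[of n] show False by simp
  qed
  with \<tau> show ?thesis by blast
qed

end
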